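(* Let $1\le k\le n$ and $\sigma\in S^k_n$. There exists a toral CW complex associated with the space $\overline{\mathbb{S}^{k-1,\sigma}_{>0}}$ and its CW-cell decomposition $$\overline{\mathbb{S}^{k-1,\sigma}_{>0}}=\bigsqcup_{l=1}^{k}\ \bigsqcup_{\gamma\in S^{l,\sigma}_n}\mathbb{S}^{l-1,\gamma}_{>0}.$$ The elements of the partition associated with this toral CW complex are homeomorphic to those in $$\{\mathbb{T}_{l+1}\times\mathbb{S}^{l,\gamma}_{>0}:\ \gamma\in S^{l+1,\sigma}_n,\ 0\le l\le k-1\}.$$ There is no even dimensional toral cell.
   Context: $S^k_n$ is the set of permutations $\sigma$ of $\{1,\dots,n\}$ with $\sigma(i)<\sigma(j)$ for $i<j\le k$ and for $k<i<j\le n$. For $\sigma\in S^k_n$ and $l\le k$, $S^{l,\sigma}_n=\{\gamma\in S^l_n:\{\sigma(i):i>k\}\subseteq\{\gamma(i):i>l\}\}$. For $\gamma\in S^l_n$, $\mathbb{S}^{l-1,\gamma}_{>0}=\{(c_1,\dots,c_n)\in\mathbb{R}^n:\ \sum_{i\le l}c_{\gamma(i)}^2=1,\ c_{\gamma(i)}>0\ (i\le l),\ c_{\gamma(i)}=0\ (i>l)\}$, an open $(l-1)$-cell. $\mathbb{T}_m$ is an $m$-dimensional torus $(\mathbb{S}^1)^m$ and $\mathbb{B}^d$ the open $d$-ball. Toral CW complex: a Hausdorff space $X$ with a finite partition into open toral cells, associated with a regular CW complex $\tilde X$, such that the following hold. (i) Each toral cell $\mathfrak{C}$ corresponds to an open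 CW cell $e$ of $\tilde X$, of dimension $d$ say, and there is a homeomorphism $g:\mathfrak{C}\to T\times e$, where $T=\mathbb{T}_{d+1}$ (an odd-dimensional toral cell, of dimension $2d+1$) or $T=\mathbb{T}_{d+2}$ (an even-dimensional toral cell, of dimension $2d+2$). (ii) Let $\tilde\Phi:\overline{\mathbb{B}^d}\to\bar e$ be the attaching homeomorphism of $e$. There is an attaching homeomorphism $\Phi:\overline{T\times\mathbb{B}^d}\to\overline{\mathfrak{C}}\subseteq X$ with $\Phi(\partial(T\times\mathbb{B}^d))$ contained in the union of the toral cells of lower dimension and $g(\Phi(s,y))=(s,\tilde\Phi(y))$ for $(s,y)\in T\times\mathbb{B}^d$. Here $\overline{T\times\mathbb{B}^d}$ is a space which, as a set, is the disjoint union, over the cells $e'\subseteq\bar e$ of $\tilde X$, of $T_{e'}\times\tilde\Phi^{-1}(e')$, where $T_{e'}$ is the torus fiber of the toral cell over $e'$. It carries a metrizable topology which is the product topology on each piece, in which $T\times\mathbb{B}^d$ is a dense, relatively compact, open subset, in which no sequence in one piece converges to a point of another piece of equal or higher dimension, and in which a sequence $(s^{x_j},x_j)$ in a higher dimensional piece converges to $(s^y,y)$ in a lower dimensional piece when $x_j\to y$ in $\overline{\mathbb{B}^d}$ and those circle components of $s^{x_j}$ that correspond to the circle components of the fiber over $y$ converge to $s^y$, the remaining circle components collapsing to a point. *)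

theory Defs
  imports "HOL-Analysis.Analysis" "HOL-Library.Disjoint_Sets"
begin

definition closed_ball_top :: "nat \<Rightarrow> (nat \<Rightarrow> real) topology" where
  "closed_ball_top d = subtopology (Euclidean_space d) {x. (\<Sum>i<d. x i ^ 2) \<le> 1}"

definition open_ball :: "nat \<Rightarrow> (nat \<Rightarrow> real) set" where
  "open_ball d = {x \<in> topspace (Euclidean_space d). (\<Sum>i<d. x i ^ 2) < 1}"

definition torus :: "nat \<Rightarrow> (nat \<Rightarrow> complex) topology" where
  "torus m = product_topology (\<lambda>_. top_of_set (sphere (0::complex) 1)) {..<m}"


(* In a regular CW complex the attaching maps are homeomorphisms from the closed ball onto the
   closed cell. The finite closed cover by closed cells makes the closure-finiteness and weak
   topology axioms automatic. The cell e has dimension d e and attaching map phi e. *)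
definition regular_CW_complex ::
  "'y topology \<Rightarrow> 'y set set \<Rightarrow> ('y set \<Rightarrow> nat) \<Rightarrow> ('y set \<Rightarrow> (nat \<Rightarrow> real) \<Rightarrow> 'y) \<Rightarrow> bool" where
  "regular_CW_complex Y E d \<phi> \<longleftrightarrow>
     Hausdorff_space Y \<and> finite E \<and> partition_on (topspace Y) E \<and>
     (\<forall>e\<in>E. homeomorphic_map (closed_ball_top (d e)) (subtopology Y (Y closure_of e)) (\<phi> e) \<and>
            \<phi> e ` open_ball (d e) = e \<and>
            \<phi> e ` (topspace (closed_ball_top (d e)) - open_ball (d e))
              \<subseteq> \<Union>{e' \<in> E. d e' < d e})"

(* The piece over e' of the closure of T x B for the cell e. Here m e' is the dimension of the
   torus fiber of the toral cell over e'. *)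
definition closure_piece ::
  "('y set \<Rightarrow> nat) \<Rightarrow> ('y set \<Rightarrow> (nat \<Rightarrow> real) \<Rightarrow> 'y) \<Rightarrow> ('y set \<Rightarrow> nat) \<Rightarrow> 'y set \<Rightarrow> 'y set
     \<Rightarrow> ((nat \<Rightarrow> complex) \<times> (nat \<Rightarrow> real)) set" where
  "closure_piece d \<phi> m e e' =
     topspace (torus (m e')) \<times> {y \<in> topspace (closed_ball_top (d e)). \<phi> e y \<in> e'}"

(* W is the space written as the closure of T x B, for the cell e. For a cell e'' in the closure
   of e', the injection iota e'' e' says which circle components of the fiber over e'
   correspond to those of the fiber over e''. The other components are unconstrained in the
   convergence condition: they collapse. *)
definition toral_closure ::
  "'y topology \<Rightarrow> 'y set set \<Rightarrow> ('y set \<Rightarrow> nat) \<Rightarrow> ('y set \<Rightarrow> (nat \<Rightarrow> real) \<Rightarrow> 'y) \<Rightarrow> ('y set \<Rightarrow> nat)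
     \<Rightarrow> ('y set \<Rightarrow> 'y set \<Rightarrow> nat \<Rightarrow> nat) \<Rightarrow> 'y set
     \<Rightarrow> ((nat \<Rightarrow> complex) \<times> (nat \<Rightarrow> real)) topology \<Rightarrow> bool" where
  "toral_closure Y E d \<phi> m \<iota> e W \<longleftrightarrow>
     (let F = {e' \<in> E. e' \<subseteq> Y closure_of e};
          P = closure_piece d \<phi> m e;
          TB = topspace (torus (m e)) \<times> open_ball (d e);
          tdim = (\<lambda>e'. m e' + d e')
      in
       topspace W = (\<Union>e'\<in>F. P e') \<and>
       metrizable_space W \<and>
       (\<forall>e'\<in>F. subtopology W (P e') =
          prod_topology (torus (m e')) (subtopology (closed_ball_top (d e)) {y. \<phi> e y \<in> e'})) \<and>
       openin W TB \<and> W closure_of TB = topspace W \<and> compactin W (W closure_of TB) \<and>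
       (\<forall>e'\<in>F. \<forall>e''\<in>F. e' \<noteq> e'' \<and> tdim e' \<le> tdim e'' \<longrightarrow>
          \<not> (\<exists>f p. range f \<subseteq> P e' \<and> p \<in> P e'' \<and> limitin W f p sequentially)) \<and>
       (\<forall>e'\<in>F. \<forall>e''\<in>F. tdim e'' < tdim e' \<longrightarrow>
          (\<forall>s x t y. (\<forall>j. (s j, x j) \<in> P e') \<and> (t, y) \<in> P e'' \<and>
             limitin (closed_ball_top (d e)) x y sequentially \<and>
             limitin (torus (m e'')) (\<lambda>j. \<lambda>i\<in>{..<m e''}. s j (\<iota> e'' e' i)) t sequentially \<longrightarrow>
             limitin W (\<lambda>j. (s j, x j)) (t, y) sequentially)))"

(* C e is the toral cell over the CW cell e, with fiber a torus of dimension m e, so C e has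
   dimension m e + d e. *)
definition toral_CW_complex ::
  "'y topology \<Rightarrow> 'y set set \<Rightarrow> ('y set \<Rightarrow> nat) \<Rightarrow> ('y set \<Rightarrow> (nat \<Rightarrow> real) \<Rightarrow> 'y)
     \<Rightarrow> 'x topology \<Rightarrow> ('y set \<Rightarrow> 'x set) \<Rightarrow> ('y set \<Rightarrow> nat) \<Rightarrow> bool" where
  "toral_CW_complex Y E d \<phi> X C m \<longleftrightarrow>
     regular_CW_complex Y E d \<phi> \<and>
     Hausdorff_space X \<and> partition_on (topspace X) (C ` E) \<and> inj_on C E \<and>
     (\<forall>e\<in>E. m e = d e + 1 \<or> m e = d e + 2) \<and>
     (\<exists>\<iota>. (\<forall>e\<in>E. \<forall>e'\<in>E. e' \<subseteq> Y closure_of e \<longrightarrow>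
              inj_on (\<iota> e' e) {..<m e'} \<and> \<iota> e' e ` {..<m e'} \<subseteq> {..<m e}) \<and>
          (\<forall>e\<in>E. \<exists>g W \<Phi>.
              homeomorphic_map (subtopology X (C e))
                (prod_topology (torus (m e)) (subtopology Y e)) g \<and>
              toral_closure Y E d \<phi> m \<iota> e W \<and>
              homeomorphic_map W (subtopology X (X closure_of (C e))) \<Phi> \<and>
              \<Phi> ` (topspace W - topspace (torus (m e)) \<times> open_ball (d e))
                \<subseteq> \<Union>{C e' |e'. e' \<in> E \<and> m e' + d e' < m e + d e} \<and>
              (\<forall>s \<in> topspace (torus (m e)). \<forall>y \<in> open_ball (d e).
                 \<Phi> (s, y) \<in> C e \<and> g (\<Phi> (s, y)) = (s, \<phi> e y))))"


definition perms_inc :: "nat \<Rightarrow> nat \<Rightarrow> (nat \<Rightarrow> nat) set" where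
  "perms_inc n k =
     {\<sigma>. \<sigma> permutes {1..n} \<and> strict_mono_on {1..k} \<sigma> \<and> strict_mono_on {k<..n} \<sigma>}"

definition perms_below :: "nat \<Rightarrow> nat \<Rightarrow> (nat \<Rightarrow> nat) \<Rightarrow> nat \<Rightarrow> (nat \<Rightarrow> nat) set" where
  "perms_below n k \<sigma> l = {\<gamma> \<in> perms_inc n l. \<sigma> ` {k<..n} \<subseteq> \<gamma> ` {l<..n}}"

(* pos_sphere n l gamma has dimension l - 1; R^n is powertop_real {1..n}. *)
definition pos_sphere :: "nat \<Rightarrow> nat \<Rightarrow> (nat \<Rightarrow> nat) \<Rightarrow> (nat \<Rightarrow> real) set" where
  "pos_sphere n l \<gamma> = {c \<in> topspace (powertop_real {1..n}).
     (\<Sum>i\<in>{1..l}. c (\<gamma> i) ^ 2) = 1 \<and> (\<forall>i\<in>{1..l}. c (\<gamma> i) > 0) \<and> (\<forall>i\<in>{l<..n}. c (\<gamma> i) = 0)}"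

definition closed_pos_sphere :: "nat \<Rightarrow> nat \<Rightarrow> (nat \<Rightarrow> nat) \<Rightarrow> (nat \<Rightarrow> real) set" where
  "closed_pos_sphere n k \<sigma> = powertop_real {1..n} closure_of pos_sphere n k \<sigma>"

definition pos_sphere_cells :: "nat \<Rightarrow> nat \<Rightarrow> (nat \<Rightarrow> nat) \<Rightarrow> (nat \<Rightarrow> real) set set" where
  "pos_sphere_cells n k \<sigma> = {pos_sphere n l \<gamma> |l \<gamma>. l \<in> {1..k} \<and> \<gamma> \<in> perms_below n k \<sigma> l}"

end

theory Submission
  imports Defs
begin

text \<open>
Write $S = \<sigma>(\{1,\dots,k\})$. The complex is the unit sphere of $\mathbb{C}^S$, which is the join of
$k$ circles. Taking absolute values coordinatewise maps it onto the unit sphere of the closed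
orthant $\mathbb{R}_{\ge 0}^S$, a spherical simplex. The face with support $A \<subseteq> S$ is an open cell
of dimension $|A| - 1$, and polar coordinates identify its preimage with the product of this face
and the torus of dimension $|A|$. So the preimages of the faces are the toral cells, each of the odd
dimension $2|A| - 1$. When a point runs to a smaller face with support $B$, the coordinates outside
$B$ tend to $0$: exactly the circles outside $B$ collapse, and the circles in $B$ persist. This is the
degeneration that a toral CW complex prescribes.

Three things carry the proof.

\<^item> The closed faces have to be closed balls, compatibly with their interiors. The map
\<open>face_chart\<close> is an explicit homeomorphism: it lifts a point of the ball to a ray of the closed
orthant, in such a way that the boundary of the ball is what goes to the boundary of the orthant
(\<open>homeomorphic_map_face_chart\<close>).

\<^item> For one face, the map \<open>toral_chart\<close> from the set underlying the closure of torus times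
ball to the closed toral cell is a bijection. The topology of that closure is
pulled back along it, so its metrizability, compactness and limits are those of a compact subset
of $\mathbb{C}^S$. The polar coordinate map from torus times closed face is a continuous surjection
onto the closed toral cell; this gives compactness, and density of the open toral cell.

\<^item> A permutation in $S^l_n$ is determined by the set $\gamma(\{1,\dots,l\})$, and every
$l$-element set arises. The condition that defines $S^{l,\sigma}_n$ says that this set lies in $S$.
Hence the spherical cells in the statement are the faces with nonempty support $A \<subseteq> S$, each
occurring once.
\<close>

section \<open>A homeomorphism from the ball onto a spherical simplex\<close>

text \<open>
The vector \<open>(x\<^sub>0, \<dots>, x\<^sub>d)\<close> with coordinate sum zero that extends \<open>(x\<^sub>0, \<dots>, x\<^bsub>d-1\<^esub>)\<close>. This is a linear
isomorphism from $\mathbb{R}^d$ onto the hyperplane orthogonal to the diagonal of $\mathbb{R}^{d+1}$.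
\<close>

definition balanced :: "nat \<Rightarrow> (nat \<Rightarrow> real) \<Rightarrow> nat \<Rightarrow> real" where
  "balanced d x j = (if j < d then x j else - (\<Sum>i<d. x i))"

text \<open>
The least multiple of \<open>(1, \<dots>, 1)\<close> that lifts the balanced vector into the closed orthant. It
is positively homogeneous, which is what makes the ray of \<open>cone_point\<close> determine the point.
\<close>

definition depth :: "nat \<Rightarrow> (nat \<Rightarrow> real) \<Rightarrow> real" where
  "depth d x = Max ((\<lambda>j. - balanced d x j) ` {..d})"

text \<open>
The balanced vector is first lifted to the boundary of the closed orthant of $\mathbb{R}^{d+1}$ and then
raised along the diagonal by the distance from \<open>x\<close> to the unit sphere. Thus the smallest
coordinate is that distance, and it vanishes exactly for \<open>x\<close> on the sphere.
\<close>

definition cone_point :: "nat \<Rightarrow> (nat \<Rightarrow> real) \<Rightarrow> nat \<Rightarrow> real" where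
  "cone_point d x j = balanced d x j + depth d x + (1 - L2_set x {..<d})"

lemma sum_balanced: "(\<Sum>j\<le>d. balanced d x j) = 0"
  by (simp add: balanced_def flip: lessThan_Suc_atMost)

lemma depth_ge: "j \<le> d \<Longrightarrow> - balanced d x j \<le> depth d x"
  unfolding depth_def by (rule Max_ge) auto

lemma depth_attained: "\<exists>j\<le>d. depth d x = - balanced d x j"
proof -
  have "depth d x \<in> (\<lambda>j. - balanced d x j) ` {..d}"
    unfolding depth_def by (rule Max_in) auto
  then show ?thesis by auto
qed

lemma depth_eqI:
  assumes "\<And>j. j \<le> d \<Longrightarrow> - balanced d x j \<le> r" and "j \<le> d" "- balanced d x j = r"
  shows "depth d x = r"
  using assms depth_ge[of j d x] depth_attained[of d x] by fastforce

lemma depth_scale: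
  assumes "0 \<le> r" and "\<And>j. j \<le> d \<Longrightarrow> balanced d x j = r * balanced d y j"
  shows "depth d x = r * depth d y"
proof -
  obtain j where j: "j \<le> d" "depth d y = - balanced d y j"
    using depth_attained by blast
  show ?thesis
  proof (rule depth_eqI[OF _ j(1)])
    show "- balanced d x i \<le> r * depth d y" if "i \<le> d" for i
      using mult_left_mono[OF depth_ge[OF that, of y] assms(1)] assms(2)[OF that] by simp
  qed (use j assms in auto)
qed

lemma continuous_on_balanced: "continuous_on UNIV (\<lambda>x. balanced d x j)"
  unfolding balanced_def
  by (cases "j < d") (auto intro!: continuous_intros)

lemma continuous_on_Max_image:
  fixes f :: "'j \<Rightarrow> 'a::topological_space \<Rightarrow> real"
  assumes "finite J" "J \<noteq> {}" "\<And>j. j \<in> J \<Longrightarrow> continuous_on S (f j)"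
  shows "continuous_on S (\<lambda>x. Max ((\<lambda>j. f j x) ` J))"
  using assms
proof (induction J rule: finite_ne_induct)
  case (insert j J)
  have "Max ((\<lambda>j. f j x) ` insert j J) = max (f j x) (Max ((\<lambda>j. f j x) ` J))" for x
    using insert.hyps by simp
  then show ?case
    using insert by (auto intro!: continuous_on_max)
qed simp

lemma continuous_on_cone_point: "continuous_on UNIV (\<lambda>x. cone_point d x j)"
proof -
  have "continuous_on UNIV (\<lambda>x. depth d x)"
    unfolding depth_def
    by (intro continuous_on_Max_image) (auto intro!: continuous_intros continuous_on_balanced)
  then show ?thesis
    unfolding cone_point_def L2_set_def
    by (intro continuous_intros continuous_on_balanced) auto
qed

lemma cone_point_ge: "j \<le> d \<Longrightarrow> 1 - L2_set x {..<d} \<le> cone_point d x j"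
  using depth_ge[of j d x] by (simp add: cone_point_def)

lemma cone_point_attains_min: "\<exists>j\<le>d. cone_point d x j = 1 - L2_set x {..<d}"
  using depth_attained[of d x] by (auto simp: cone_point_def)

text \<open>
If all coordinates vanished, then \<open>x\<close> would lie on the unit sphere and its balanced vector would
be constant; the only constant vector with sum zero is \<open>0\<close>.
\<close>

lemma cone_point_nonzero:
  assumes "L2_set x {..<d} \<le> 1"
  shows "\<exists>j\<le>d. 0 < cone_point d x j"
proof (rule ccontr)
  assume "\<not> ?thesis"
  then have le0: "cone_point d x j \<le> 0" if "j \<le> d" for j
    using that by (auto simp: not_less)
  have nx: "L2_set x {..<d} = 1"
    using assms le0[of 0] cone_point_ge[of 0 d x] by simp
  then have "cone_point d x j = 0" if "j \<le> d" for j
    using le0[OF that] cone_point_ge[OF that, of x] by simp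
  then have eq: "balanced d x j = - depth d x" if "j \<le> d" for j
    using that nx by (force simp: cone_point_def)
  have "(\<Sum>j\<le>d. balanced d x j) = (\<Sum>j\<le>d. - depth d x)"
    by (rule sum.cong) (auto simp: eq)
  then have "depth d x = 0"
    by (simp add: sum_balanced)
  then have "x j = 0" if "j < d" for j
    using eq[of j] that by (simp add: balanced_def)
  then have "L2_set x {..<d} = 0"
    by (simp add: L2_set_def)
  with nx show False by simp
qed

text \<open>
Projecting two cone points on a common ray along the diagonal shows that the balanced vectors
differ by the factor \<open>r\<close>, hence so do depth and norm. Comparing the diagonal parts leaves
\<open>1 - r\<parallel>y\<parallel> = r - r\<parallel>y\<parallel>\<close>, so \<open>r = 1\<close>.
\<close>

lemma cone_point_ray_inj:
  assumes "0 < r" and eq: "\<And>j. j \<le> d \<Longrightarrow> cone_point d x j = r * cone_point d y j"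
    and "i < d"
  shows "x i = y i"
proof -
  define h where "h z = depth d z + (1 - L2_set z {..<d})" for z
  have cp: "cone_point d z j = balanced d z j + h z" for z j
    by (simp add: cone_point_def h_def)
  have "(\<Sum>j\<le>d. cone_point d z j) = real (Suc d) * h z" for z
    by (simp add: cp sum.distrib sum_balanced)
  moreover have "(\<Sum>j\<le>d. cone_point d x j) = r * (\<Sum>j\<le>d. cone_point d y j)"
    by (simp add: sum_distrib_left eq)
  ultimately have "real (Suc d) * h x = real (Suc d) * (r * h y)"
    by (metis mult.left_commute)
  then have hxy: "h x = r * h y" by (simp only: mult_cancel_left) auto
  then have bal: "balanced d x j = r * balanced d y j" if "j \<le> d" for j
    using eq[OF that] by (simp add: cp algebra_simps)
  then have xj: "x j = r * y j" if "j < d" for j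
    using that bal[of j] by (simp add: balanced_def)
  then have "L2_set x {..<d} = L2_set (\<lambda>j. r * y j) {..<d}"
    by (intro L2_set_cong) auto
  then have "L2_set x {..<d} = r * L2_set y {..<d}"
    using assms(1) by (simp add: L2_set_right_distrib)
  moreover have "depth d x = r * depth d y"
    using assms(1) bal by (intro depth_scale) auto
  ultimately have "r = 1"
    using hxy by (simp add: h_def algebra_simps)
  then show ?thesis
    using xj[OF \<open>i < d\<close>] by simp
qed

text \<open>
Given \<open>c\<close> with mean \<open>a\<close> and minimum \<open>\<mu>\<close>, the vector \<open>c - a\<close> is the balanced vector of some \<open>y\<close> of
depth \<open>a - \<mu>\<close>. The cone point of \<open>r y\<close> is \<open>r (c - \<mu>) + (1 - r\<parallel>y\<parallel>)\<close>, which equals \<open>r c\<close> when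
\<open>r (\<mu> + \<parallel>y\<parallel>) = 1\<close>.
\<close>

lemma cone_point_ray_surj:
  assumes nonneg: "\<And>j. j \<le> d \<Longrightarrow> 0 \<le> c j" and nz: "j0 \<le> d" "0 < c j0"
  obtains x r where "\<forall>j\<ge>d. x j = 0" "L2_set x {..<d} \<le> 1" "0 < r"
    "\<And>j. j \<le> d \<Longrightarrow> cone_point d x j = r * c j"
proof -
  define \<mu> where "\<mu> = Min (c ` {..d})"
  \<comment> \<open>Subtracting the mean makes \<open>c\<close> balanced.\<close>
  define a where "a = (\<Sum>j\<le>d. c j) / real (Suc d)"
  define y where "y j = (if j < d then c j - a else 0)" for j
  have "\<mu> \<in> c ` {..d}" unfolding \<mu>_def by (rule Min_in) auto
  then obtain j1 where j1: "j1 \<le> d" "c j1 = \<mu>" by auto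
  have \<mu>le: "\<mu> \<le> c j" if "j \<le> d" for j unfolding \<mu>_def using that by simp
  have \<mu>0: "0 \<le> \<mu>" using j1 nonneg by force
  have "(\<Sum>i<d. c i) + c d = real (Suc d) * a"
    by (simp add: a_def flip: lessThan_Suc_atMost)
  then have bal: "balanced d y j = c j - a" if "j \<le> d" for j
    using that by (cases "j = d") (auto simp: balanced_def y_def sum_subtractf algebra_simps)
  define N where "N = L2_set y {..<d}"
  have N0: "0 \<le> N" by (simp add: N_def)
  have "0 < \<mu> + N"
  proof (rule ccontr)
    assume "\<not> ?thesis"
    with \<mu>0 N0 have "\<mu> = 0" "N = 0" by auto
    then have "y j = 0" if "j < d" for j
      using that by (simp add: N_def L2_set_eq_0_iff)
    then have "balanced d y j = 0" for j by (auto simp: balanced_def)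
    then have "c j = a" if "j \<le> d" for j using bal[OF that] by simp
    then show False using nz j1 \<open>\<mu> = 0\<close> by force
  qed
  define r where "r = 1 / (\<mu> + N)"
  have r0: "0 < r" using \<open>0 < \<mu> + N\<close> by (simp add: r_def)
  have "r * (\<mu> + N) = 1" using \<open>0 < \<mu> + N\<close> by (simp add: r_def)
  then have rN: "r * N + r * \<mu> = 1" by (simp add: algebra_simps)
  define x where "x j = r * y j" for j
  have Nx: "L2_set x {..<d} = r * N"
    using r0 by (simp add: x_def [abs_def] N_def L2_set_right_distrib)
  have balx: "balanced d x j = r * (c j - a)" if "j \<le> d" for j
  proof -
    have "balanced d x j = r * balanced d y j"
      by (simp add: balanced_def x_def sum_distrib_left)
    with bal[OF that] show ?thesis by simp
  qed
  have "depth d x = r * (a - \<mu>)"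
    using j1 r0 \<mu>le by (intro depth_eqI[of d x _ j1]) (auto simp: balx algebra_simps)
  then have "cone_point d x j = r * c j" if "j \<le> d" for j
    using rN that by (simp add: cone_point_def balx Nx algebra_simps)
  moreover have "L2_set x {..<d} \<le> 1"
    using rN r0 \<mu>0 unfolding Nx by (smt (verit) mult_nonneg_nonneg)
  moreover have "\<forall>j\<ge>d. x j = 0" by (simp add: x_def y_def)
  ultimately show ?thesis using that r0 by blast
qed

section \<open>Faces of the spherical simplex\<close>

text \<open>
The circles of the torus over a face are numbered from \<open>0\<close>, while the coordinates in the support
\<open>A\<close> are arbitrary indices. An arbitrary enumeration of each finite set translates between the two; it
is fixed once per set, so that the inclusion of circles between two faces can be written down.
\<close>

definition nth_elem :: "'i set \<Rightarrow> nat \<Rightarrow> 'i" where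
  "nth_elem A = (SOME f. bij_betw f {..<card A} A)"

definition elem_index :: "'i set \<Rightarrow> 'i \<Rightarrow> nat" where
  "elem_index A = inv_into {..<card A} (nth_elem A)"

lemma bij_betw_nth_elem: "finite A \<Longrightarrow> bij_betw (nth_elem A) {..<card A} A"
  unfolding nth_elem_def lessThan_atLeast0 by (rule someI_ex[OF ex_bij_betw_nat_finite])

lemma bij_betw_elem_index: "finite A \<Longrightarrow> bij_betw (elem_index A) A {..<card A}"
  unfolding elem_index_def by (rule bij_betw_inv_into[OF bij_betw_nth_elem])

lemma nth_elem_in: "finite A \<Longrightarrow> j < card A \<Longrightarrow> nth_elem A j \<in> A"
  using bij_betw_nth_elem[of A] by (auto simp: bij_betw_def)

lemma elem_index_less: "finite A \<Longrightarrow> i \<in> A \<Longrightarrow> elem_index A i < card A"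
  using bij_betw_elem_index[of A] by (auto simp: bij_betw_def)

lemma nth_elem_elem_index: "finite A \<Longrightarrow> i \<in> A \<Longrightarrow> nth_elem A (elem_index A i) = i"
  unfolding elem_index_def by (rule bij_betw_inv_into_right[OF bij_betw_nth_elem])

lemma elem_index_nth: "finite A \<Longrightarrow> j < card A \<Longrightarrow> elem_index A (nth_elem A j) = j"
  unfolding elem_index_def by (rule bij_betw_inv_into_left[OF bij_betw_nth_elem]) auto

lemma sum_elem_index: "finite A \<Longrightarrow> (\<Sum>i\<in>A. f (elem_index A i)) = (\<Sum>j<card A. f j)"
  by (rule sum.reindex_bij_betw[OF bij_betw_elem_index])

definition supp :: "'i set \<Rightarrow> ('i \<Rightarrow> real) \<Rightarrow> 'i set" where
  "supp I c = {i \<in> I. c i \<noteq> 0}"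

text \<open>
The coordinate space \<open>powertop_real I\<close> consists of functions extensional on \<open>I\<close>, so points of
the sphere must be extensional too.
\<close>

definition orthant_sphere :: "'i set \<Rightarrow> ('i \<Rightarrow> real) set" where
  "orthant_sphere I = {c \<in> extensional I. (\<forall>i\<in>I. 0 \<le> c i) \<and> (\<Sum>i\<in>I. (c i)\<^sup>2) = 1}"

definition open_face :: "'i set \<Rightarrow> 'i set \<Rightarrow> ('i \<Rightarrow> real) set" where
  "open_face I A = {c \<in> orthant_sphere I. supp I c = A}"

definition closed_face :: "'i set \<Rightarrow> 'i set \<Rightarrow> ('i \<Rightarrow> real) set" where
  "closed_face I A = {c \<in> orthant_sphere I. supp I c \<subseteq> A}"

lemma supp_nonempty: "c \<in> orthant_sphere I \<Longrightarrow> supp I c \<noteq> {}"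
  by (force simp: orthant_sphere_def supp_def)

lemma open_face_subset_closed: "open_face I A \<subseteq> closed_face I A"
  by (auto simp: open_face_def closed_face_def)

lemma closed_face_eq_Union_open_faces:
  "closed_face I A = (\<Union>B\<in>{B. B \<subseteq> A \<and> B \<noteq> {}}. open_face I B)"
  using supp_nonempty by (fastforce simp: open_face_def closed_face_def)

lemma topspace_powertop: "topspace (product_topology (\<lambda>_. euclidean) I) = extensional I"
  by (simp add: PiE_def)

lemma closed_face_extensional: "closed_face I A \<subseteq> extensional I"
  by (auto simp: closed_face_def orthant_sphere_def)

lemma open_face_extensional: "open_face I A \<subseteq> extensional I"
  by (auto simp: open_face_def orthant_sphere_def)

lemma closed_ball_top_eq:
  "closed_ball_top d = top_of_set {x. (\<forall>j\<ge>d. x j = 0) \<and> L2_set x {..<d} \<le> 1}"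
  by (simp add: closed_ball_top_def Euclidean_space_def subtopology_subtopology
      euclidean_product_topology L2_set_def Int_def)

lemma topspace_closed_ball_top:
  "topspace (closed_ball_top d) = {x. (\<forall>j\<ge>d. x j = 0) \<and> L2_set x {..<d} \<le> 1}"
  by (simp add: closed_ball_top_eq)

lemma open_ball_eq: "open_ball d = {x. (\<forall>j\<ge>d. x j = 0) \<and> L2_set x {..<d} < 1}"
  by (simp add: open_ball_def topspace_Euclidean_space L2_set_def)

lemma open_ball_subset: "open_ball d \<subseteq> topspace (closed_ball_top d)"
  by (auto simp: open_ball_eq topspace_closed_ball_top)

lemma Hausdorff_powertop:
  "Hausdorff_space (product_topology (\<lambda>_. euclidean :: 'a::metric_space topology) I)"
  by (simp add: Hausdorff_space_product_topology Hausdorff_space_euclidean)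

lemma compact_space_closed_ball_top: "compact_space (closed_ball_top d)"
proof -
  let ?B = "{x. (\<forall>j\<ge>d. x j = 0) \<and> L2_set x {..<d} \<le> (1::real)}"
  have "compactin (product_topology (\<lambda>i::nat. euclideanreal) UNIV) (PiE UNIV (\<lambda>i. {-1..1}))"
    by (simp add: compactin_PiE)
  then have cp: "compact (PiE UNIV (\<lambda>i::nat. {-1..1::real}))"
    by (simp add: euclidean_product_topology)
  have cl: "closed ?B"
    unfolding L2_set_def
    by (intro closed_Collect_conj closed_Collect_all closed_Collect_imp closed_Collect_eq
        closed_Collect_le continuous_intros open_Collect_const) auto
  have "x j \<in> {-1..1}" if "x \<in> ?B" for x j
  proof (cases "j < d")
    case True
    then have "\<bar>x j\<bar> \<le> L2_set (\<lambda>j. \<bar>x j\<bar>) {..<d}"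
      by (intro member_le_L2_set) auto
    also have "\<dots> = L2_set x {..<d}" by (simp add: L2_set_def)
    also have "\<dots> \<le> 1" using that by simp
    finally show ?thesis by auto
  qed (use that in auto)
  then have "PiE UNIV (\<lambda>i::nat. {-1..1::real}) \<inter> ?B = ?B" by blast
  then have "compact ?B"
    using compact_Int_closed[OF cp cl] by (simp only:)
  then show ?thesis
    by (simp add: closed_ball_top_eq compact_space_subtopology)
qed

text \<open>
A boundary point is the limit of its multiples by factors below \<open>1\<close>.
\<close>

lemma closure_of_open_ball: "closed_ball_top d closure_of open_ball d = topspace (closed_ball_top d)"
proof
  show "topspace (closed_ball_top d) \<subseteq> closed_ball_top d closure_of open_ball d"
  proof
    fix x assume x: "x \<in> topspace (closed_ball_top d)"
    define f where "f t = (\<lambda>j. t * x j)" for t :: real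
    have norm_f: "L2_set (f t) {..<d} = t * L2_set x {..<d}" if "0 \<le> t" for t
      using that by (simp add: f_def L2_set_right_distrib)
    have "continuous_on {0..1} f"
      unfolding f_def by (intro continuous_on_coordinatewise_then_product continuous_intros)
    moreover have "f t \<in> topspace (closed_ball_top d)" if "t \<in> {0..1}" for t
      using x that mult_le_one[of t "L2_set x {..<d}"]
      by (simp add: topspace_closed_ball_top norm_f) (simp add: f_def)
    ultimately have cont: "continuous_map (top_of_set {0..1}) (closed_ball_top d) f"
      unfolding closed_ball_top_eq
      by (auto simp: continuous_map_subtopology_eu)
    have "f t \<in> open_ball d" if "t \<in> {0..<1}" for t
    proof -
      have "t * L2_set x {..<d} \<le> t * 1"
        using x that by (intro mult_left_mono) (auto simp: topspace_closed_ball_top)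
      then show ?thesis
        using x that by (simp add: open_ball_eq norm_f topspace_closed_ball_top) (simp add: f_def)
    qed
    then have sub: "f ` {0..<1} \<subseteq> open_ball d" by blast
    have "(1::real) \<in> top_of_set {0..1} closure_of {0..<1}"
      by (simp add: closure_of_subtopology Int_absorb1 atLeastLessThan_subseteq_atLeastAtMost_iff)
    then have "f 1 \<in> closed_ball_top d closure_of (f ` {0..<1})"
      using continuous_map_image_closure_subset[OF cont] by blast
    then have "f 1 \<in> closed_ball_top d closure_of open_ball d"
      using closure_of_mono[OF sub] by blast
    then show "x \<in> closed_ball_top d closure_of open_ball d"
      by (simp add: f_def)
  qed
qed (rule closure_of_subset_topspace)

text \<open>
The cone point, transported to the coordinates in \<open>A\<close> and normalised to the unit sphere.
Normalisation identifies the unit sphere with the rays, so bijectivity onto the closed face is the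
statement that each ray of the closed orthant contains exactly one cone point.
\<close>

definition face_chart :: "'i set \<Rightarrow> 'i set \<Rightarrow> (nat \<Rightarrow> real) \<Rightarrow> 'i \<Rightarrow> real" where
  "face_chart I A x = (\<lambda>i\<in>I. if i \<in> A
     then cone_point (card A - 1) x (elem_index A i) / L2_set (cone_point (card A - 1) x) {..<card A}
     else 0)"

lemma cone_point_nonneg:
  "x \<in> topspace (closed_ball_top d) \<Longrightarrow> j \<le> d \<Longrightarrow> 0 \<le> cone_point d x j"
  using cone_point_ge[of j d x] by (simp add: topspace_closed_ball_top)

lemma L2_set_cone_point_pos:
  assumes "x \<in> topspace (closed_ball_top d)"
  shows "0 < L2_set (cone_point d x) {..<Suc d}"
proof -
  obtain j where j: "j \<le> d" "0 < cone_point d x j"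
    using cone_point_nonzero[of x d] assms by (auto simp: topspace_closed_ball_top)
  then have "L2_set (cone_point d x) {..<Suc d} \<noteq> 0"
    by (subst L2_set_eq_0_iff) force+
  then show ?thesis by (simp add: less_le)
qed

text \<open>
A face of dimension \<open>d\<close> in the coordinate space over \<open>I\<close>, given by its support \<open>A\<close>.
\<close>

locale face =
  fixes I A :: "'i set" and d :: nat
  assumes finite_I: "finite I" and sub: "A \<subseteq> I" and card_A: "card A = Suc d"
begin

lemma finite_A: "finite A"
  using finite_I sub by (rule finite_subset[rotated])

lemma face_chart_apply:
  "i \<in> A \<Longrightarrow> face_chart I A x i = cone_point d x (elem_index A i) / L2_set (cone_point d x) {..<Suc d}"
  "i \<in> I \<Longrightarrow> i \<notin> A \<Longrightarrow> face_chart I A x i = 0"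
  using sub by (auto simp: face_chart_def card_A)

lemma elem_index_le: "i \<in> A \<Longrightarrow> elem_index A i \<le> d"
  using elem_index_less[OF finite_A, of i] by (simp add: card_A)

lemma sum_squares_face:
  assumes "\<And>i. i \<in> I \<Longrightarrow> i \<notin> A \<Longrightarrow> c i = (0::real)"
  shows "(\<Sum>i\<in>I. (c i)\<^sup>2) = (\<Sum>i\<in>A. (c i)\<^sup>2)"
  using assms sub finite_I by (intro sum.mono_neutral_right) auto

lemma face_chart_in_closed_face:
  assumes x: "x \<in> topspace (closed_ball_top d)"
  shows "face_chart I A x \<in> closed_face I A"
proof -
  let ?N = "L2_set (cone_point d x) {..<Suc d}"
  have N: "0 < ?N" using L2_set_cone_point_pos[OF x] .
  have "(\<Sum>i\<in>I. (face_chart I A x i)\<^sup>2) = (\<Sum>i\<in>A. (cone_point d x (elem_index A i) / ?N)\<^sup>2)"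
    using sum_squares_face[of "face_chart I A x"] by (simp add: face_chart_apply)
  also have "\<dots> = (\<Sum>j<Suc d. (cone_point d x j / ?N)\<^sup>2)"
    using sum_elem_index[OF finite_A, of "\<lambda>j. (cone_point d x j / ?N)\<^sup>2"] by (simp only: card_A)
  also have "\<dots> = (\<Sum>j<Suc d. (cone_point d x j)\<^sup>2) / ?N\<^sup>2"
    by (simp only: power_divide sum_divide_distrib)
  also have "(\<Sum>j<Suc d. (cone_point d x j)\<^sup>2) = ?N\<^sup>2"
    unfolding L2_set_def by (rule real_sqrt_pow2[symmetric]) (rule sum_nonneg, simp)
  finally have "(\<Sum>i\<in>I. (face_chart I A x i)\<^sup>2) = 1"
    using N by simp
  moreover have "0 \<le> face_chart I A x i" if "i \<in> I" for i
    using that N cone_point_nonneg[OF x elem_index_le, of i]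
    by (cases "i \<in> A") (auto simp: face_chart_apply)
  moreover have "supp I (face_chart I A x) \<subseteq> A"
    using face_chart_apply(2) by (auto simp: supp_def)
  moreover have "face_chart I A x \<in> extensional I"
    by (simp add: face_chart_def)
  ultimately show ?thesis by (simp add: closed_face_def orthant_sphere_def)
qed

text \<open>
The point lies in the open face when the smallest coordinate of the cone point is positive, and
this coordinate is the distance to the unit sphere.
\<close>

lemma face_chart_in_open_face_iff:
  assumes x: "x \<in> topspace (closed_ball_top d)"
  shows "face_chart I A x \<in> open_face I A \<longleftrightarrow> x \<in> open_ball d"
proof -
  let ?N = "L2_set (cone_point d x) {..<Suc d}"
  have N: "0 < ?N" using L2_set_cone_point_pos[OF x] .
  have "face_chart I A x \<in> open_face I A \<longleftrightarrow> (\<forall>i\<in>A. cone_point d x (elem_index A i) \<noteq> 0)"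
  proof -
    have "face_chart I A x i \<noteq> 0 \<longleftrightarrow> i \<in> A \<and> cone_point d x (elem_index A i) \<noteq> 0" if "i \<in> I" for i
      using that N by (cases "i \<in> A") (auto simp: face_chart_apply)
    then show ?thesis
      using face_chart_in_closed_face[OF x] sub
      by (auto simp: closed_face_def open_face_def supp_def)
  qed
  also have "\<dots> \<longleftrightarrow> (\<forall>j\<in>elem_index A ` A. cone_point d x j \<noteq> 0)"
    by simp
  also have "elem_index A ` A = {..d}"
    using bij_betw_elem_index[OF finite_A] by (auto simp: bij_betw_def card_A)
  also have "(\<forall>j\<in>{..d}. cone_point d x j \<noteq> 0) \<longleftrightarrow> L2_set x {..<d} < 1"
  proof
    assume "\<forall>j\<in>{..d}. cone_point d x j \<noteq> 0"
    then have "1 - L2_set x {..<d} \<noteq> 0"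
      using cone_point_attains_min[of d x] by (metis atMost_iff)
    then show "L2_set x {..<d} < 1"
      using x by (simp add: topspace_closed_ball_top)
  next
    assume "L2_set x {..<d} < 1"
    then show "\<forall>j\<in>{..d}. cone_point d x j \<noteq> 0"
      using cone_point_ge[of _ d x] by (metis atMost_iff diff_gt_0_iff_gt not_less)
  qed
  finally show ?thesis
    using x by (simp add: open_ball_eq topspace_closed_ball_top)
qed

lemma face_chart_image: "face_chart I A ` topspace (closed_ball_top d) = closed_face I A"
proof
  show "closed_face I A \<subseteq> face_chart I A ` topspace (closed_ball_top d)"
  proof
    fix c assume c: "c \<in> closed_face I A"
    have c0: "c i = 0" if "i \<in> I" "i \<notin> A" for i
      using c that by (auto simp: closed_face_def supp_def)
    have c1: "(\<Sum>i\<in>A. (c i)\<^sup>2) = 1"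
      using sum_squares_face[of c] c0 c by (simp add: closed_face_def orthant_sphere_def)
    have nonneg: "0 \<le> c i" if "i \<in> I" for i
      using c that by (auto simp: closed_face_def orthant_sphere_def)
    obtain i0 where i0: "i0 \<in> A" "0 < c i0"
      using supp_nonempty[of c I] c nonneg by (force simp: closed_face_def supp_def)
    have en: "nth_elem A j \<in> A" if "j \<le> d" for j
      using nth_elem_in[OF finite_A] that by (simp add: card_A)
    obtain x r where x: "\<forall>j\<ge>d. x j = 0" "L2_set x {..<d} \<le> 1" and r: "0 < r"
      and cp: "\<And>j. j \<le> d \<Longrightarrow> cone_point d x j = r * c (nth_elem A j)"
    proof (rule cone_point_ray_surj[of d "\<lambda>j. c (nth_elem A j)" "elem_index A i0"])
      show "0 \<le> c (nth_elem A j)" if "j \<le> d" for j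
        using en[OF that] nonneg sub by blast
      show "elem_index A i0 \<le> d" "0 < c (nth_elem A (elem_index A i0))"
        using i0 elem_index_le nth_elem_elem_index[OF finite_A] by auto
    qed blast
    have xB: "x \<in> topspace (closed_ball_top d)"
      using x by (simp add: topspace_closed_ball_top)
    have "(\<Sum>j<Suc d. (cone_point d x j)\<^sup>2) = (\<Sum>j<card A. (r * c (nth_elem A j))\<^sup>2)"
      using cp by (simp only: card_A) (auto intro!: sum.cong)
    also have "\<dots> = (\<Sum>i\<in>A. (r * c i)\<^sup>2)"
      by (rule sum.reindex_bij_betw[OF bij_betw_nth_elem[OF finite_A]])
    also have "\<dots> = r\<^sup>2"
      using c1 by (simp add: power_mult_distrib flip: sum_distrib_left)
    finally have N: "L2_set (cone_point d x) {..<Suc d} = r"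
      using r by (simp add: L2_set_def)
    have "face_chart I A x i = c i" for i
    proof (cases "i \<in> I")
      case True
      then show ?thesis
        using r c0 cp[OF elem_index_le, of i]
        by (cases "i \<in> A") (auto simp: face_chart_apply N nth_elem_elem_index[OF finite_A])
    next
      case False
      then show ?thesis
        using c by (auto simp: face_chart_def closed_face_def orthant_sphere_def extensional_def)
    qed
    then show "c \<in> face_chart I A ` topspace (closed_ball_top d)"
      using xB by (metis ext image_eqI)
  qed
qed (use face_chart_in_closed_face in blast)

lemma inj_on_face_chart: "inj_on (face_chart I A) (topspace (closed_ball_top d))"
proof
  fix x y assume x: "x \<in> topspace (closed_ball_top d)" and y: "y \<in> topspace (closed_ball_top d)"
    and eq: "face_chart I A x = face_chart I A y"
  let ?N = "\<lambda>x. L2_set (cone_point d x) {..<Suc d}"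
  have N: "0 < ?N x" "0 < ?N y" using L2_set_cone_point_pos x y by auto
  have "cone_point d x j = (?N x / ?N y) * cone_point d y j" if "j \<le> d" for j
  proof -
    have j: "nth_elem A j \<in> A" "elem_index A (nth_elem A j) = j"
      using that nth_elem_in[OF finite_A] elem_index_nth[OF finite_A] by (auto simp: card_A)
    then have "cone_point d x j / ?N x = cone_point d y j / ?N y"
      using fun_cong[OF eq, of "nth_elem A j"] by (simp add: face_chart_apply)
    then show ?thesis using N by (simp add: field_simps)
  qed
  then have "x j = y j" if "j < d" for j
    using cone_point_ray_inj[of "?N x / ?N y" d x y j] N that by simp
  moreover have "x j = y j" if "d \<le> j" for j
    using x y that by (simp add: topspace_closed_ball_top)
  ultimately show "x = y" by (meson ext not_less)
qed

lemma continuous_map_face_chart: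
  "continuous_map (closed_ball_top d) (powertop_real I) (face_chart I A)"
  unfolding continuous_map_componentwise
proof (intro conjI ballI)
  show "face_chart I A ` topspace (closed_ball_top d) \<subseteq> extensional I"
    by (auto simp: face_chart_def)
  fix i assume i: "i \<in> I"
  have cont: "continuous_map (closed_ball_top d) euclideanreal (\<lambda>x. cone_point d x j)" for j
    unfolding closed_ball_top_eq continuous_map_iff_continuous
    by (rule continuous_on_subset[OF continuous_on_cone_point]) simp
  have "continuous_map (closed_ball_top d) euclideanreal (\<lambda>x. L2_set (cone_point d x) {..<Suc d})"
    unfolding closed_ball_top_eq continuous_map_iff_continuous L2_set_def
    by (intro continuous_intros continuous_on_subset[OF continuous_on_cone_point]) simp
  then show "continuous_map (closed_ball_top d) euclideanreal (\<lambda>x. face_chart I A x i)"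
    using i cont L2_set_cone_point_pos
    by (cases "i \<in> A")
      (auto simp: face_chart_apply less_imp_neq[THEN not_sym] intro!: continuous_map_real_divide)
qed

lemma homeomorphic_map_face_chart:
  "homeomorphic_map (closed_ball_top d) (subtopology (powertop_real I) (closed_face I A))
     (face_chart I A)"
proof (rule continuous_imp_homeomorphic_map)
  show "continuous_map (closed_ball_top d) (subtopology (powertop_real I) (closed_face I A))
     (face_chart I A)"
    using face_chart_image by (auto simp: continuous_map_in_subtopology continuous_map_face_chart)
  show "face_chart I A ` topspace (closed_ball_top d) =
      topspace (subtopology (powertop_real I) (closed_face I A))"
    using closed_face_extensional
    by (simp only: face_chart_image topspace_subtopology topspace_powertop) blast
qed (auto simp: compact_space_closed_ball_top Hausdorff_space_subtopology Hausdorff_powertop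
     inj_on_face_chart)

lemma face_chart_open_ball: "face_chart I A ` open_ball d = open_face I A"
proof
  show "open_face I A \<subseteq> face_chart I A ` open_ball d"
  proof
    fix c assume c: "c \<in> open_face I A"
    then obtain x where "x \<in> topspace (closed_ball_top d)" "c = face_chart I A x"
      using open_face_subset_closed face_chart_image by blast
    then show "c \<in> face_chart I A ` open_ball d"
      using c face_chart_in_open_face_iff by blast
  qed
qed (use face_chart_in_open_face_iff open_ball_subset in blast)

lemma closedin_closed_face: "closedin (powertop_real I) (closed_face I A)"
  unfolding face_chart_image[symmetric]
  using image_compactin[OF _ continuous_map_face_chart] compact_space_closed_ball_top
  by (intro compactin_imp_closedin Hausdorff_powertop) (auto simp: compact_space_def)

lemma closure_of_open_face: "powertop_real I closure_of open_face I A = closed_face I A"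
proof
  show "powertop_real I closure_of open_face I A \<subseteq> closed_face I A"
    by (intro closure_of_minimal closedin_closed_face open_face_subset_closed)
  show "closed_face I A \<subseteq> powertop_real I closure_of open_face I A"
    using continuous_map_image_closure_subset[OF continuous_map_face_chart, of "open_ball d"]
    by (simp add: closure_of_open_ball face_chart_open_ball face_chart_image)
qed

end

section \<open>Polar coordinates over a face\<close>

abbreviation complex_power :: "'i set \<Rightarrow> ('i \<Rightarrow> complex) topology" where
  "complex_power I \<equiv> product_topology (\<lambda>_. euclidean) I"

definition modulus :: "'i set \<Rightarrow> ('i \<Rightarrow> complex) \<Rightarrow> 'i \<Rightarrow> real" where
  "modulus I z = (\<lambda>i\<in>I. cmod (z i))"

definition angles :: "'i set \<Rightarrow> ('i \<Rightarrow> complex) \<Rightarrow> nat \<Rightarrow> complex" where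
  "angles A z = (\<lambda>j\<in>{..<card A}. sgn (z (nth_elem A j)))"

definition polar :: "'i set \<Rightarrow> 'i set \<Rightarrow> (nat \<Rightarrow> complex) \<Rightarrow> ('i \<Rightarrow> real) \<Rightarrow> 'i \<Rightarrow> complex" where
  "polar I A s c = (\<lambda>i\<in>I. if i \<in> A then complex_of_real (c i) * s (elem_index A i) else 0)"

text \<open>
Used both for open and for closed faces \<open>e\<close>: the points of the complex space over \<open>e\<close>.
\<close>

definition toral_cell :: "'i set \<Rightarrow> ('i \<Rightarrow> real) set \<Rightarrow> ('i \<Rightarrow> complex) set" where
  "toral_cell I e = {z \<in> extensional I. modulus I z \<in> e}"

lemma topspace_torus: "topspace (torus m) = {s \<in> extensional {..<m}. \<forall>j<m. cmod (s j) = 1}"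
  by (auto simp: torus_def PiE_def Pi_def)

lemma norm_polar:
  assumes "finite A" "s \<in> topspace (torus (card A))" "i \<in> I" "0 \<le> c i" "supp I c \<subseteq> A"
  shows "cmod (polar I A s c i) = c i"
proof (cases "i \<in> A")
  case True
  then show ?thesis
    using assms elem_index_less[of A i] by (simp add: polar_def norm_mult topspace_torus)
next
  case False
  then show ?thesis
    using assms by (auto simp: polar_def supp_def)
qed

lemma modulus_polar:
  assumes "finite A" "s \<in> topspace (torus (card A))" "c \<in> closed_face I A"
  shows "modulus I (polar I A s c) = c"
proof
  fix i show "modulus I (polar I A s c) i = c i"
  proof (cases "i \<in> I")
    case True
    then show ?thesis
      using assms norm_polar[of A s i I c]
      by (simp add: modulus_def closed_face_def orthant_sphere_def)
  next
    case False
    then show ?thesis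
      using assms(3) closed_face_extensional[of I A] extensional_arb[of c I i]
      by (auto simp: modulus_def)
  qed
qed

lemma polar_in_toral_cell:
  assumes "finite A" "s \<in> topspace (torus (card A))" "c \<in> closed_face I A"
  shows "polar I A s c \<in> toral_cell I e \<longleftrightarrow> c \<in> e"
  using modulus_polar[OF assms] by (simp add: toral_cell_def) (simp add: polar_def)

text \<open>
Where \<open>z\<close> vanishes, \<open>s\<close> may take any value. Over the boundary of a face the fiber of the
polar map is therefore a torus, and points of the closed toral cell still have polar coordinates.
\<close>

lemma polar_decomposition:
  assumes "finite A" and z: "z \<in> toral_cell I (closed_face I A)"
    and s: "\<And>i. i \<in> A \<Longrightarrow> z i \<noteq> 0 \<Longrightarrow> s (elem_index A i) = sgn (z i)"
  shows "polar I A s (modulus I z) = z"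
proof
  fix i show "polar I A s (modulus I z) i = z i"
  proof (cases "i \<in> I")
    case True
    then have "i \<in> A \<or> z i = 0"
      using z by (auto simp: toral_cell_def closed_face_def supp_def modulus_def)
    then show ?thesis
      using True s[of i] by (cases "z i = 0") (auto simp: polar_def modulus_def sgn_eq)
  next
    case False
    then show ?thesis
      using z extensional_arb[of z I i] by (simp add: polar_def toral_cell_def)
  qed
qed

lemma toral_cell_open_face_nonzero:
  "z \<in> toral_cell I (open_face I A) \<Longrightarrow> i \<in> A \<Longrightarrow> z i \<noteq> 0"
  by (auto simp: toral_cell_def open_face_def supp_def modulus_def)

lemma polar_angles:
  assumes "finite A" and "z \<in> toral_cell I (open_face I A)"
  shows "polar I A (angles A z) (modulus I z) = z"
proof (rule polar_decomposition)
  show "z \<in> toral_cell I (closed_face I A)"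
    using assms open_face_subset_closed by (auto simp: toral_cell_def)
  show "angles A z (elem_index A i) = sgn (z i)" if "i \<in> A" for i
    using that assms(1) by (simp add: angles_def elem_index_less nth_elem_elem_index)
qed (use assms in auto)

lemma angles_polar:
  assumes "finite A" "s \<in> topspace (torus (card A))" "c \<in> open_face I A"
  shows "angles A (polar I A s c) = s"
proof
  fix j show "angles A (polar I A s c) j = s j"
  proof (cases "j < card A")
    case True
    let ?i = "nth_elem A j"
    have i: "?i \<in> A" using nth_elem_in[OF assms(1) True] .
    then have "?i \<in> I" "0 < c ?i"
      using assms(3) by (force simp: open_face_def supp_def orthant_sphere_def less_le)+
    then have "polar I A s c ?i = complex_of_real (c ?i) * s j"
      using i True assms(1) by (simp add: polar_def elem_index_nth)
    moreover have "cmod (s j) = 1"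
      using assms(2) True by (simp add: topspace_torus)
    ultimately show ?thesis
      using True \<open>0 < c ?i\<close> by (simp add: angles_def sgn_eq norm_mult)
  next
    case False
    then show ?thesis
      using assms(2) extensional_arb[of s "{..<card A}" j] by (simp add: angles_def topspace_torus)
  qed
qed

lemma continuous_map_complex_mult:
  fixes f g :: "'a \<Rightarrow> complex"
  assumes "continuous_map X euclidean f" "continuous_map X euclidean g"
  shows "continuous_map X euclidean (\<lambda>x. f x * g x)"
proof -
  have "continuous_map X euclidean (\<lambda>x. (f x, g x))"
    using continuous_map_pairedI[OF assms] by (simp add: prod_topology_euclidean)
  moreover have "continuous_map euclidean euclidean (\<lambda>p::complex \<times> complex. fst p * snd p)"
    by (simp add: continuous_on_mult continuous_on_fst continuous_on_snd)
  ultimately show ?thesis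
    using continuous_map_compose[of X euclidean "\<lambda>x. (f x, g x)" euclidean "\<lambda>p. fst p * snd p"]
    by (simp add: o_def)
qed

lemma continuous_map_euclidean_compose:
  assumes "continuous_map X euclidean f" "continuous_on UNIV h"
  shows "continuous_map X euclidean (\<lambda>x. h (f x))"
  using continuous_map_compose[OF assms(1), of euclidean h] assms(2) by (simp add: o_def)

lemma continuous_map_modulus: "continuous_map (complex_power I) (powertop_real I) (modulus I)"
  unfolding continuous_map_componentwise
proof (intro conjI ballI)
  fix i assume i: "i \<in> I"
  have "continuous_map (complex_power I) euclidean (\<lambda>z. cmod (z i))"
    by (rule continuous_map_euclidean_compose[OF continuous_map_product_projection[OF i]])
      (intro continuous_intros)
  with i show "continuous_map (complex_power I) euclideanreal (\<lambda>z. modulus I z i)"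
    by (simp add: modulus_def)
qed (auto simp: modulus_def)

lemma continuous_map_torus_component:
  "j < m \<Longrightarrow> continuous_map (torus m) euclidean (\<lambda>s. s j)"
  unfolding torus_def
  using continuous_map_product_projection[of j "{..<m}" "\<lambda>_. top_of_set (sphere (0::complex) 1)"]
  by (auto intro: continuous_map_into_fulltopology)

lemma continuous_map_polar:
  assumes "finite A"
  shows "continuous_map (prod_topology (torus (card A)) (powertop_real I)) (complex_power I)
    (\<lambda>(s, c). polar I A s c)"
  unfolding continuous_map_componentwise
proof (intro conjI ballI)
  let ?X = "prod_topology (torus (card A)) (powertop_real I)"
  fix i assume i: "i \<in> I"
  show "continuous_map ?X euclidean (\<lambda>p. (\<lambda>(s, c). polar I A s c) p i)"
  proof (cases "i \<in> A")
    case True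
    have "continuous_map ?X euclidean (\<lambda>p. snd p i)"
      using continuous_map_compose[OF continuous_map_snd continuous_map_product_projection[OF i]]
      by (simp add: o_def)
    then have "continuous_map ?X euclidean (\<lambda>p. complex_of_real (snd p i))"
      by (rule continuous_map_euclidean_compose) (intro continuous_intros)
    moreover have "continuous_map ?X euclidean (\<lambda>p. fst p (elem_index A i))"
      using continuous_map_compose[OF continuous_map_fst
          continuous_map_torus_component[OF elem_index_less[OF assms True]]]
      by (simp add: o_def)
    ultimately have "continuous_map ?X euclidean
        (\<lambda>p. complex_of_real (snd p i) * fst p (elem_index A i))"
      by (rule continuous_map_complex_mult)
    then show ?thesis using i True by (simp add: polar_def case_prod_unfold)
  next
    case False
    then show ?thesis using i by (simp add: polar_def case_prod_unfold)
  qed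
qed (auto simp: polar_def)

lemma continuous_map_angles:
  assumes "finite A" "A \<subseteq> I"
  shows "continuous_map (subtopology (complex_power I) (toral_cell I (open_face I A)))
    (torus (card A)) (angles A)"
  unfolding torus_def continuous_map_componentwise
proof (intro conjI ballI)
  let ?X = "subtopology (complex_power I) (toral_cell I (open_face I A))"
  fix j assume j: "j \<in> {..<card A}"
  then have i: "nth_elem A j \<in> A" using nth_elem_in[OF assms(1)] by simp
  have ne: "z (nth_elem A j) \<noteq> 0" if "z \<in> topspace ?X" for z
    using toral_cell_open_face_nonzero[of z I, OF _ i] that by simp
  have "continuous_map ?X euclidean (\<lambda>z. z (nth_elem A j))"
    using i assms(2)
    by (intro continuous_map_from_subtopology continuous_map_product_projection) auto
  then have "continuous_map ?X (top_of_set (-{0})) (\<lambda>z. z (nth_elem A j))"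
    using ne by (auto simp: continuous_map_in_subtopology)
  moreover have "continuous_map (top_of_set (-{0::complex})) (top_of_set (sphere 0 1)) sgn"
    by (auto simp: continuous_map_in_subtopology sgn_zero_iff norm_sgn
        intro!: continuous_on_sgn continuous_on_id)
  ultimately have "continuous_map ?X (top_of_set (sphere 0 1)) (sgn \<circ> (\<lambda>z. z (nth_elem A j)))"
    by (rule continuous_map_compose)
  then show "continuous_map ?X (top_of_set (sphere 0 1)) (\<lambda>z. angles A z j)"
    using j by (simp add: angles_def o_def)
qed (auto simp: angles_def)

text \<open>
Over an open face no coordinate in the support vanishes, so the angles are continuous there.
\<close>

lemma homeomorphic_maps_polar:
  assumes "finite A" "A \<subseteq> I"
  shows "homeomorphic_maps (subtopology (complex_power I) (toral_cell I (open_face I A)))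
    (prod_topology (torus (card A)) (subtopology (powertop_real I) (open_face I A)))
    (\<lambda>z. (angles A z, modulus I z)) (\<lambda>(s, c). polar I A s c)"
  unfolding homeomorphic_maps_def
proof (intro conjI ballI)
  let ?X = "subtopology (complex_power I) (toral_cell I (open_face I A))"
  let ?Z = "prod_topology (torus (card A)) (subtopology (powertop_real I) (open_face I A))"
  have "continuous_map ?X (subtopology (powertop_real I) (open_face I A)) (modulus I)"
    by (auto simp: continuous_map_in_subtopology toral_cell_def
        intro!: continuous_map_from_subtopology continuous_map_modulus)
  then show "continuous_map ?X ?Z (\<lambda>z. (angles A z, modulus I z))"
    by (intro continuous_map_pairedI continuous_map_angles assms)
  have *: "c \<in> closed_face I A" if "c \<in> open_face I A" for c
    using that open_face_subset_closed by blast
  have "continuous_map ?Z (complex_power I) (\<lambda>(s, c). polar I A s c)"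
    unfolding prod_topology_subtopology
    by (intro continuous_map_from_subtopology continuous_map_polar assms)
  then show "continuous_map ?Z ?X (\<lambda>(s, c). polar I A s c)"
    by (auto simp: continuous_map_in_subtopology polar_in_toral_cell[OF assms(1) _ *])
  show "(\<lambda>(s, c). polar I A s c) (angles A z, modulus I z) = z" if "z \<in> topspace ?X" for z
    using that polar_angles[OF assms(1)] by auto
  show "(\<lambda>z. (angles A z, modulus I z)) ((\<lambda>(s, c). polar I A s c) p) = p"
    if "p \<in> topspace ?Z" for p
    using that angles_polar[OF assms(1)] modulus_polar[OF assms(1) _ *]
    by auto
qed

context face
begin

lemma polar_image_open:
  "(\<lambda>(s, c). polar I A s c) ` (topspace (torus (card A)) \<times> open_face I A) =
     toral_cell I (open_face I A)"
proof -
  have t1: "topspace (subtopology (powertop_real I) (open_face I A)) = open_face I A"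
    using open_face_extensional by (simp only: topspace_subtopology topspace_powertop) blast
  have t2: "topspace (subtopology (complex_power I) (toral_cell I (open_face I A))) =
      toral_cell I (open_face I A)"
    by (simp only: topspace_subtopology topspace_powertop) (auto simp: toral_cell_def)
  have "homeomorphic_map
      (prod_topology (torus (card A)) (subtopology (powertop_real I) (open_face I A)))
      (subtopology (complex_power I) (toral_cell I (open_face I A))) (\<lambda>(s, c). polar I A s c)"
    using homeomorphic_maps_polar[OF finite_A sub] unfolding homeomorphic_maps_map by blast
  from homeomorphic_imp_surjective_map[OF this] show ?thesis
    by (simp only: topspace_prod_topology t1 t2)
qed

lemma polar_image_closed:
  "(\<lambda>(s, c). polar I A s c) ` (topspace (torus (card A)) \<times> closed_face I A) =
     toral_cell I (closed_face I A)"
proof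
  show "toral_cell I (closed_face I A) \<subseteq>
      (\<lambda>(s, c). polar I A s c) ` (topspace (torus (card A)) \<times> closed_face I A)"
  proof
    fix z assume z: "z \<in> toral_cell I (closed_face I A)"
    define s where "s = (\<lambda>j\<in>{..<card A}. if z (nth_elem A j) = 0 then 1 else sgn (z (nth_elem A j)))"
    have "polar I A s (modulus I z) = z"
      by (rule polar_decomposition[OF finite_A z])
        (simp add: s_def elem_index_less nth_elem_elem_index finite_A)
    moreover have "s \<in> topspace (torus (card A))"
      by (simp add: topspace_torus s_def norm_sgn)
    moreover have "modulus I z \<in> closed_face I A"
      using z by (simp add: toral_cell_def)
    ultimately show "z \<in> (\<lambda>(s, c). polar I A s c) ` (topspace (torus (card A)) \<times> closed_face I A)"
      by force
  qed
qed (auto simp: polar_in_toral_cell finite_A)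

text \<open>
Density comes from the closed face: the polar map is continuous on torus times closed face, where
torus times open face is dense.
\<close>

lemma closure_of_toral_cell:
  "complex_power I closure_of toral_cell I (open_face I A) = toral_cell I (closed_face I A)"
proof
  have "closedin (complex_power I) {z \<in> topspace (complex_power I). modulus I z \<in> closed_face I A}"
    by (rule closedin_continuous_map_preimage[OF continuous_map_modulus closedin_closed_face])
  then have "closedin (complex_power I) (toral_cell I (closed_face I A))"
    by (simp only: topspace_powertop toral_cell_def)
  then show "complex_power I closure_of toral_cell I (open_face I A) \<subseteq> toral_cell I (closed_face I A)"
    using open_face_subset_closed by (intro closure_of_minimal) (auto simp: toral_cell_def)
  show "toral_cell I (closed_face I A) \<subseteq> complex_power I closure_of toral_cell I (open_face I A)"
    using continuous_map_image_closure_subset[OF continuous_map_polar[OF finite_A, of I],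
        of "topspace (torus (card A)) \<times> open_face I A"]
    by (simp only: closure_of_Times closure_of_topspace closure_of_open_face
        polar_image_open polar_image_closed)
qed

lemma compactin_closed_toral_cell:
  "compactin (complex_power I) (toral_cell I (closed_face I A))"
proof -
  have "compact_space (torus (card A))"
    by (simp add: torus_def compact_space_product_topology compact_space_subtopology)
  then have "compactin (torus (card A)) (topspace (torus (card A)))"
    by (simp only: compact_space_def)
  moreover have "compactin (powertop_real I) (closed_face I A)"
    unfolding face_chart_image[symmetric]
    using compact_space_closed_ball_top continuous_map_face_chart
    by (intro image_compactin) (auto simp: compact_space_def)
  ultimately have "compactin (prod_topology (torus (card A)) (powertop_real I))
      (topspace (torus (card A)) \<times> closed_face I A)"
    by (simp add: compactin_Times)
  from image_compactin[OF this continuous_map_polar[OF finite_A]] show ?thesis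
    by (simp only: polar_image_closed)
qed

end

section \<open>The closure of torus times ball\<close>

text \<open>
The topology on the closure of torus times ball is obtained by this transport of structure.
\<close>

lemma homeomorphic_map_pullback_topology:
  assumes inj: "inj_on f S" and sub: "f ` S \<subseteq> topspace T"
  shows "homeomorphic_map (pullback_topology S f T) (subtopology T (f ` S)) f"
proof (rule bijective_open_imp_homeomorphic_map)
  have top: "topspace (pullback_topology S f T) = S"
    using sub by (auto simp: topspace_pullback_topology)
  have "openin (pullback_topology S f T) {x \<in> topspace (pullback_topology S f T). f x \<in> U}"
    if "openin T U" for U
  proof -
    have "{x \<in> topspace (pullback_topology S f T). f x \<in> U} = f -` U \<inter> S"
      unfolding top by blast
    with that show ?thesis by (auto simp: openin_pullback_topology)
  qed
  then have "continuous_map (pullback_topology S f T) T f"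
    using sub unfolding continuous_map_def by (auto simp: top)
  then show "continuous_map (pullback_topology S f T) (subtopology T (f ` S)) f"
    by (auto simp: continuous_map_in_subtopology top)
  show "open_map (pullback_topology S f T) (subtopology T (f ` S)) f"
    unfolding open_map_def
  proof (intro allI impI)
    fix V assume "openin (pullback_topology S f T) V"
    then obtain U where U: "openin T U" "V = f -` U \<inter> S"
      by (auto simp: openin_pullback_topology)
    then have "f ` V = U \<inter> f ` S" by blast
    with U show "openin (subtopology T (f ` S)) (f ` V)"
      by (auto simp: openin_subtopology)
  qed
  show "f ` topspace (pullback_topology S f T) = topspace (subtopology T (f ` S))"
    using sub by (auto simp: top)
  show "inj_on f (topspace (pullback_topology S f T))"
    by (simp add: top inj)
qed

lemma topology_eq_if_same_homeomorphic_map: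
  assumes X: "homeomorphic_map X Z f" and Y: "homeomorphic_map Y Z f"
    and top: "topspace X = topspace Y"
  shows "X = Y"
  unfolding topology_eq
  by (auto simp: homeomorphic_map_openness_eq[OF X] homeomorphic_map_openness_eq[OF Y] top)

lemma limitin_homeomorphic_map_iff:
  assumes f: "homeomorphic_map X Z f" and u: "\<And>j. u j \<in> topspace X" and l: "l \<in> topspace X"
  shows "limitin X u l F \<longleftrightarrow> limitin Z (\<lambda>j. f (u j)) (f l) F"
proof
  assume "limitin X u l F"
  from continuous_map_limit[OF homeomorphic_imp_continuous_map[OF f] this]
  show "limitin Z (\<lambda>j. f (u j)) (f l) F" by (simp add: o_def)
next
  assume lim: "limitin Z (\<lambda>j. f (u j)) (f l) F"
  obtain g where g: "homeomorphic_maps X Z f g"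
    using f homeomorphic_map_maps by blast
  then have "continuous_map Z X g" and gf: "\<And>x. x \<in> topspace X \<Longrightarrow> g (f x) = x"
    by (auto simp: homeomorphic_maps_def)
  from continuous_map_limit[OF this(1) lim] show "limitin X u l F"
    by (simp add: o_def gf u l)
qed

text \<open>
The torus component \<open>s\<close> of a point over \<open>y\<close> has one entry for each coordinate in the support of the
image of \<open>y\<close>. So the support, and not \<open>A\<close>, selects the polar map: on each piece \<open>toral_chart\<close>
uses the torus of the face that \<open>y\<close> is mapped to.
\<close>

definition toral_chart :: "'i set \<Rightarrow> 'i set \<Rightarrow> (nat \<Rightarrow> complex) \<times> (nat \<Rightarrow> real) \<Rightarrow> 'i \<Rightarrow> complex" where
  "toral_chart I A = (\<lambda>(s, y). polar I (supp I (face_chart I A y)) s (face_chart I A y))"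

lemma toral_cell_Union: "toral_cell I (\<Union>E) = (\<Union>e\<in>E. toral_cell I e)"
  by (auto simp: toral_cell_def)

lemma limitin_power_component_zero:
  fixes l :: "'i \<Rightarrow> 'a::real_normed_vector"
  assumes "limitin (product_topology (\<lambda>_. euclidean) I) f l sequentially"
    and "i \<in> I" and "\<And>j. f j i = 0"
  shows "l i = 0"
proof -
  have "(\<lambda>j. f j i) \<longlonglongrightarrow> l i"
    using assms(1,2) by (simp add: limitin_componentwise)
  then show ?thesis
    using assms(3) by (simp add: LIMSEQ_const_iff)
qed

lemma faceI: "finite I \<Longrightarrow> A \<subseteq> I \<Longrightarrow> A \<noteq> {} \<Longrightarrow> face I A (card A - 1)"
  using finite_subset[of A I] card_gt_0_iff[of A] by unfold_locales auto

context face
begin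

lemma A_nonempty: "A \<noteq> {}"
  using card_A by auto

lemma face_of: "B \<subseteq> A \<Longrightarrow> B \<noteq> {} \<Longrightarrow> face I B (card B - 1)"
  using sub finite_I by (intro faceI) auto

definition piece :: "'i set \<Rightarrow> ((nat \<Rightarrow> complex) \<times> (nat \<Rightarrow> real)) set" where
  "piece B = topspace (torus (card B)) \<times> {y \<in> topspace (closed_ball_top d). face_chart I A y \<in> open_face I B}"

definition pieces :: "((nat \<Rightarrow> complex) \<times> (nat \<Rightarrow> real)) set" where
  "pieces = (\<Union>B\<in>{B. B \<subseteq> A \<and> B \<noteq> {}}. piece B)"

text \<open>
The space written as the closure of torus times ball. Its points over the boundary of the ball
carry tori of smaller dimension, so its topology is not that of a product.
\<close>

definition chart_space :: "((nat \<Rightarrow> complex) \<times> (nat \<Rightarrow> real)) topology" where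
  "chart_space = pullback_topology pieces (toral_chart I A) (complex_power I)"

lemma toral_chart_eq_polar:
  "face_chart I A y \<in> open_face I B \<Longrightarrow> toral_chart I A (s, y) = polar I B s (face_chart I A y)"
  by (simp add: toral_chart_def open_face_def)

lemma toral_chart_image_piece:
  assumes "B \<subseteq> A" "B \<noteq> {}"
  shows "toral_chart I A ` piece B = toral_cell I (open_face I B)"
proof -
  have "open_face I B \<subseteq> closed_face I A"
    using assms by (auto simp: closed_face_def open_face_def)
  then have "face_chart I A ` {y \<in> topspace (closed_ball_top d). face_chart I A y \<in> open_face I B}
      = open_face I B"
    unfolding face_chart_image[symmetric] by blast
  moreover have "(\<lambda>(s, y). (s, g y)) ` (T \<times> Y) = T \<times> g ` Y"
    for g :: "(nat \<Rightarrow> real) \<Rightarrow> 'i \<Rightarrow> real" and T :: "(nat \<Rightarrow> complex) set" and Y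
    by (force simp: image_iff)
  ultimately have img: "(\<lambda>(s, y). (s, face_chart I A y)) ` piece B =
      topspace (torus (card B)) \<times> open_face I B"
    by (simp only: piece_def)
  have "toral_chart I A ` piece B =
      (\<lambda>(s, c). polar I B s c) ` (\<lambda>(s, y). (s, face_chart I A y)) ` piece B"
    unfolding image_image by (rule image_cong) (auto simp: piece_def toral_chart_eq_polar)
  then show ?thesis
    using face.polar_image_open[OF face_of[OF assms]] by (simp only: img)
qed

lemma toral_chart_image_pieces:
  "toral_chart I A ` pieces = toral_cell I (closed_face I A)"
  by (simp add: pieces_def image_UN toral_chart_image_piece closed_face_eq_Union_open_faces
      toral_cell_Union)

lemma piece_subset_pieces: "B \<subseteq> A \<Longrightarrow> B \<noteq> {} \<Longrightarrow> piece B \<subseteq> pieces"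
  by (auto simp: pieces_def)

lemma modulus_toral_chart:
  assumes "(s, y) \<in> piece B" "B \<subseteq> A"
  shows "modulus I (toral_chart I A (s, y)) = face_chart I A y"
  using assms finite_subset[OF assms(2) finite_A] open_face_subset_closed[of I B]
  by (auto simp: piece_def toral_chart_eq_polar intro!: modulus_polar)

text \<open>
The moduli determine \<open>y\<close>, hence the piece; on one piece the angles determine the torus component.
\<close>

lemma inj_on_toral_chart: "inj_on (toral_chart I A) pieces"
proof
  fix p q assume "p \<in> pieces" "q \<in> pieces" and eq: "toral_chart I A p = toral_chart I A q"
  then obtain B C where "p \<in> piece B" "B \<subseteq> A" "q \<in> piece C" "C \<subseteq> A"
    unfolding pieces_def by auto
  then obtain s y t z where p: "p = (s, y)" "(s, y) \<in> piece B" "B \<subseteq> A"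
    and q: "q = (t, z)" "(t, z) \<in> piece C" "C \<subseteq> A"
    by (metis prod.collapse)
  have "face_chart I A y = face_chart I A z"
    using eq p q modulus_toral_chart by metis
  then have yz: "y = z"
    using p(2) q(2) inj_on_face_chart by (auto simp: piece_def inj_on_def)
  then have BC: "B = C"
    using p(2) q(2) by (auto simp: piece_def open_face_def)
  have "polar I B s (face_chart I A y) = polar I B t (face_chart I A y)"
    using eq p q BC yz by (auto simp: toral_chart_eq_polar piece_def)
  then have "s = t"
    using p q BC yz angles_polar[OF finite_subset[OF p(3) finite_A]]
    by (auto simp: piece_def) metis
  with yz p q show "p = q" by simp
qed

lemma toral_cell_extensional: "toral_cell I e \<subseteq> extensional I"
  by (auto simp: toral_cell_def)

lemma homeomorphic_map_toral_chart:
  "homeomorphic_map chart_space (subtopology (complex_power I) (toral_cell I (closed_face I A)))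
     (toral_chart I A)"
  unfolding chart_space_def toral_chart_image_pieces[symmetric]
  by (intro homeomorphic_map_pullback_topology inj_on_toral_chart)
    (simp only: toral_chart_image_pieces topspace_powertop toral_cell_extensional)

lemma topspace_chart_space: "topspace chart_space = pieces"
proof -
  have "toral_chart I A ` pieces \<subseteq> topspace (complex_power I)"
    by (simp only: toral_chart_image_pieces topspace_powertop toral_cell_extensional)
  then show ?thesis
    unfolding chart_space_def topspace_pullback_topology by blast
qed

lemma homeomorphic_map_toral_chart_piece:
  assumes B: "B \<subseteq> A" "B \<noteq> {}"
  shows "homeomorphic_map (subtopology chart_space (piece B))
    (subtopology (complex_power I) (toral_cell I (open_face I B))) (toral_chart I A)"
proof -
  have "toral_cell I (open_face I B) \<subseteq> toral_cell I (closed_face I A)"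
    using B by (auto simp: toral_cell_def closed_face_def open_face_def)
  then have eq: "subtopology (subtopology (complex_power I) (toral_cell I (closed_face I A)))
      (toral_cell I (open_face I B)) = subtopology (complex_power I) (toral_cell I (open_face I B))"
    by (simp add: subtopology_subtopology Int_absorb1)
  have "toral_chart I A ` (topspace chart_space \<inter> piece B) =
      topspace (subtopology (complex_power I) (toral_cell I (closed_face I A))) \<inter> toral_cell I (open_face I B)"
    using piece_subset_pieces[OF B] \<open>toral_cell I (open_face I B) \<subseteq> _\<close>
    by (simp only: topspace_chart_space topspace_subtopology topspace_powertop Int_absorb1
        toral_chart_image_piece[OF B] toral_cell_extensional)
  from homeomorphic_map_subtopologies[OF homeomorphic_map_toral_chart this]
  show ?thesis by (simp only: eq)
qed

lemma homeomorphic_map_toral_chart_product: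
  assumes B: "B \<subseteq> A" "B \<noteq> {}"
  shows "homeomorphic_map
    (prod_topology (torus (card B)) (subtopology (closed_ball_top d) {y. face_chart I A y \<in> open_face I B}))
    (subtopology (complex_power I) (toral_cell I (open_face I B))) (toral_chart I A)"
proof -
  let ?U = "{y. face_chart I A y \<in> open_face I B}"
  have sub': "open_face I B \<subseteq> closed_face I A"
    using B by (auto simp: closed_face_def open_face_def)
  have "homeomorphic_map (subtopology (closed_ball_top d) ?U)
      (subtopology (subtopology (powertop_real I) (closed_face I A)) (open_face I B)) (face_chart I A)"
    by (rule homeomorphic_map_subtopologies_alt[OF homeomorphic_map_face_chart]) simp
  then have "homeomorphic_map (subtopology (closed_ball_top d) ?U)
      (subtopology (powertop_real I) (open_face I B)) (face_chart I A)"
    using sub' by (simp add: subtopology_subtopology Int_absorb1)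
  then obtain g where g: "homeomorphic_maps (subtopology (closed_ball_top d) ?U)
      (subtopology (powertop_real I) (open_face I B)) (face_chart I A) g"
    using homeomorphic_map_maps by blast
  have "homeomorphic_maps (torus (card B)) (torus (card B)) id id"
    by (simp add: homeomorphic_maps_def)
  with g have "homeomorphic_maps (prod_topology (torus (card B)) (subtopology (closed_ball_top d) ?U))
      (prod_topology (torus (card B)) (subtopology (powertop_real I) (open_face I B)))
      (\<lambda>(s, y). (id s, face_chart I A y)) (\<lambda>(s, y). (id s, g y))"
    by (simp only: homeomorphic_maps_prod simp_thms)
  then have 1: "homeomorphic_map (prod_topology (torus (card B)) (subtopology (closed_ball_top d) ?U))
      (prod_topology (torus (card B)) (subtopology (powertop_real I) (open_face I B)))
      (\<lambda>(s, y). (id s, face_chart I A y))"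
    using homeomorphic_maps_map by blast
  have 2: "homeomorphic_map (prod_topology (torus (card B)) (subtopology (powertop_real I) (open_face I B)))
      (subtopology (complex_power I) (toral_cell I (open_face I B))) (\<lambda>(s, c). polar I B s c)"
    using homeomorphic_maps_polar[of B I] B sub finite_subset[OF B(1) finite_A]
    unfolding homeomorphic_maps_map by blast
  show ?thesis
    by (rule homeomorphic_map_eq[OF homeomorphic_map_compose[OF 1 2]])
      (auto simp: toral_chart_eq_polar)
qed

text \<open>
Both topologies make \<open>toral_chart\<close> a homeomorphism onto the same toral cell: the left one by
construction, the right one because it is the composition of \<open>face_chart\<close> with polar coordinates.
\<close>

lemma subtopology_chart_space_piece:
  assumes B: "B \<subseteq> A" "B \<noteq> {}"
  shows "subtopology chart_space (piece B) =
    prod_topology (torus (card B)) (subtopology (closed_ball_top d) {y. face_chart I A y \<in> open_face I B})"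
proof (rule topology_eq_if_same_homeomorphic_map)
  show "topspace (subtopology chart_space (piece B)) = topspace (prod_topology (torus (card B))
      (subtopology (closed_ball_top d) {y. face_chart I A y \<in> open_face I B}))"
    using piece_subset_pieces[OF B]
    by (simp only: topspace_subtopology topspace_chart_space Int_absorb1 topspace_prod_topology)
      (auto simp: piece_def)
qed (use homeomorphic_map_toral_chart_piece[OF B] homeomorphic_map_toral_chart_product[OF B] in auto)

lemma piece_top: "piece A = topspace (torus (card A)) \<times> open_ball d"
  using face_chart_in_open_face_iff open_ball_subset by (auto simp: piece_def)

lemma metrizable_space_chart_space: "metrizable_space chart_space"
proof -
  have "metrizable_space (complex_power I)"
    using finite_I by (simp add: metrizable_space_product_topology metrizable_space_euclidean
        countable_finite)
  then have "metrizable_space (subtopology (complex_power I) (toral_cell I (closed_face I A)))"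
    by (rule metrizable_space_subtopology)
  then show ?thesis
    using homeomorphic_metrizable_space homeomorphic_map_imp_homeomorphic_space
      homeomorphic_map_toral_chart by blast
qed

lemma openin_chart_space_piece_top: "openin chart_space (piece A)"
proof -
  let ?Z = "subtopology (complex_power I) (toral_cell I (closed_face I A))"
  have "openin ?Z {z \<in> topspace ?Z. z i \<in> -{0}}" if "i \<in> A" for i
    using that sub
    by (intro openin_continuous_map_preimage[where Y = euclidean]
        continuous_map_from_subtopology continuous_map_product_projection) auto
  then have "openin ?Z (\<Inter>i\<in>A. {z \<in> topspace ?Z. z i \<in> -{0}})"
    by (intro openin_INT2 finite_A A_nonempty)
  also have "(\<Inter>i\<in>A. {z \<in> topspace ?Z. z i \<in> -{0}}) = {z \<in> topspace ?Z. \<forall>i\<in>A. z i \<noteq> 0}"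
    using A_nonempty by auto
  also have "\<dots> = toral_cell I (open_face I A)"
    using sub
    by (simp only: topspace_subtopology topspace_powertop)
      (auto simp: toral_cell_def open_face_def closed_face_def supp_def modulus_def)
  finally show ?thesis
    using homeomorphic_map_openness[OF homeomorphic_map_toral_chart, of "piece A"]
      piece_subset_pieces[of A] A_nonempty
    by (simp add: topspace_chart_space toral_chart_image_piece)
qed

lemma closure_of_piece_top: "chart_space closure_of piece A = topspace chart_space"
proof -
  let ?T = "toral_cell I (closed_face I A)"
  have sub': "toral_cell I (open_face I A) \<subseteq> ?T"
    using open_face_subset_closed by (auto simp: toral_cell_def)
  have pA: "piece A \<subseteq> topspace chart_space"
    using piece_subset_pieces[of A] A_nonempty by (simp add: topspace_chart_space)
  have "toral_chart I A ` (chart_space closure_of piece A) =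
      subtopology (complex_power I) ?T closure_of toral_cell I (open_face I A)"
    using homeomorphic_map_closure_of[OF homeomorphic_map_toral_chart pA] A_nonempty
    by (simp add: toral_chart_image_piece)
  also have "\<dots> = ?T"
    using sub' by (simp add: closure_of_subtopology Int_absorb1 closure_of_toral_cell)
  also have "\<dots> = toral_chart I A ` topspace chart_space"
    by (simp add: topspace_chart_space toral_chart_image_pieces)
  finally show ?thesis
    using inj_on_toral_chart closure_of_subset_topspace[of chart_space]
    by (simp add: inj_on_image_eq_iff topspace_chart_space)
qed

lemma compactin_chart_space: "compactin chart_space (topspace chart_space)"
proof -
  have "compactin (subtopology (complex_power I) (toral_cell I (closed_face I A)))
      (toral_chart I A ` topspace chart_space)"
    using compactin_closed_toral_cell
    by (simp add: compactin_subtopology topspace_chart_space toral_chart_image_pieces)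
  then show ?thesis
    using homeomorphic_map_compactness[OF homeomorphic_map_toral_chart] by blast
qed

lemma limitin_chart_space_iff:
  assumes "\<And>j. u j \<in> pieces" "p \<in> pieces"
  shows "limitin chart_space u p F \<longleftrightarrow>
    limitin (complex_power I) (\<lambda>j. toral_chart I A (u j)) (toral_chart I A p) F"
proof -
  have "toral_chart I A q \<in> toral_cell I (closed_face I A)" if "q \<in> pieces" for q
    using that toral_chart_image_pieces by blast
  then show ?thesis
    using limitin_homeomorphic_map_iff[OF homeomorphic_map_toral_chart, of u p F] assms
    by (simp add: topspace_chart_space limitin_subtopology)
qed

text \<open>
A coordinate that vanishes along a sequence vanishes in the limit, so supports can only shrink.
\<close>

lemma chart_space_no_limit:
  assumes B: "B \<subseteq> A" "B \<noteq> {}" and C: "C \<subseteq> A" "C \<noteq> {}"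
    and "B \<noteq> C" "card B \<le> card C" and f: "range f \<subseteq> piece B" and p: "p \<in> piece C"
  shows "\<not> limitin chart_space f p sequentially"
proof
  assume "limitin chart_space f p sequentially"
  then have lim: "limitin (complex_power I) (\<lambda>j. toral_chart I A (f j)) (toral_chart I A p) sequentially"
    using f p piece_subset_pieces[OF B] piece_subset_pieces[OF C] by (subst (asm) limitin_chart_space_iff) auto
  have cf: "toral_chart I A (f j) \<in> toral_cell I (open_face I B)" for j
    using f toral_chart_image_piece[OF B] by blast
  have cp: "toral_chart I A p \<in> toral_cell I (open_face I C)"
    using p toral_chart_image_piece[OF C] by blast
  have "C \<subseteq> B"
  proof (rule ccontr)
    assume "\<not> C \<subseteq> B"
    then obtain i where i: "i \<in> C" "i \<notin> B" by blast
    then have "i \<in> I" using C sub by blast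
    then have "toral_chart I A (f j) i = 0" for j
      using cf[of j] i by (auto simp: toral_cell_def open_face_def supp_def modulus_def)
    then have "toral_chart I A p i = 0"
      using limitin_power_component_zero[OF lim \<open>i \<in> I\<close>] by blast
    then show False
      using toral_cell_open_face_nonzero[OF cp i(1)] by blast
  qed
  then show False
    using assms card_seteq[of B C] finite_subset[OF B(1) finite_A] by blast
qed

text \<open>
Convergence can be checked on the coordinates of $\mathbb{C}^I$. In a coordinate of the limit support
\<open>C\<close>, modulus and angle converge. In any other coordinate the modulus tends to \<open>0\<close>, so the
angle has no influence.
\<close>

lemma chart_space_limit:
  assumes B: "B \<subseteq> A" "B \<noteq> {}" and C: "C \<subseteq> A" "C \<noteq> {}"
    and sx: "\<And>j. (s j, x j) \<in> piece B" and ty: "(t, y) \<in> piece C"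
    and limx: "limitin (closed_ball_top d) x y sequentially"
    and lims: "limitin (torus (card C)) (\<lambda>j. \<lambda>i\<in>{..<card C}. s j (elem_index B (nth_elem C i))) t sequentially"
  shows "limitin chart_space (\<lambda>j. (s j, x j)) (t, y) sequentially"
proof -
  define c where "c j = face_chart I A (x j)" for j
  define c' where "c' = face_chart I A y"
  have fin: "finite B" "finite C" using B C finite_A finite_subset by auto
  have cB: "c j \<in> open_face I B" for j
    using sx[of j] by (simp add: piece_def c_def)
  have cC: "c' \<in> open_face I C"
    using ty by (simp add: piece_def c'_def)
  have lim: "limitin (powertop_real I) c c' sequentially"
    using continuous_map_limit[OF continuous_map_face_chart limx] by (simp add: o_def c_def[abs_def] c'_def)
  then have limc: "(\<lambda>j. c j i) \<longlonglongrightarrow> c' i" if "i \<in> I" for i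
    using that by (simp add: limitin_componentwise)
  \<comment> \<open>A coordinate that vanishes along the whole sequence vanishes at the limit.\<close>
  have "C \<subseteq> B"
  proof
    fix i assume i: "i \<in> C"
    then have "i \<in> I" "c' i \<noteq> 0" using cC by (auto simp: open_face_def supp_def)
    then obtain j where "c j i \<noteq> 0"
      using limitin_power_component_zero[OF lim] by blast
    then show "i \<in> B"
      using cB[of j] \<open>i \<in> I\<close> by (auto simp: open_face_def supp_def)
  qed
  have ch: "toral_chart I A (s j, x j) = polar I B (s j) (c j)" for j
    using cB[of j] by (simp add: toral_chart_eq_polar c_def)
  have ch': "toral_chart I A (t, y) = polar I C t c'"
    using cC by (simp add: toral_chart_eq_polar c'_def)
  \<comment> \<open>Two cases: a circle that persists in the limit, and a circle that collapses.\<close>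
  have comp: "(\<lambda>j. polar I B (s j) (c j) i) \<longlonglongrightarrow> polar I C t c' i" if i: "i \<in> I" for i
  proof (cases "i \<in> C")
    case True
    have "limitin euclidean (\<lambda>j. (\<lambda>k\<in>{..<card C}. s j (elem_index B (nth_elem C k))) (elem_index C i))
        (t (elem_index C i)) sequentially"
      using continuous_map_limit[OF continuous_map_torus_component[OF elem_index_less[OF fin(2) True]] lims]
      by (simp add: o_def)
    then have "(\<lambda>j. s j (elem_index B i)) \<longlonglongrightarrow> t (elem_index C i)"
      using True fin by (simp add: elem_index_less nth_elem_elem_index)
    then have "(\<lambda>j. complex_of_real (c j i) * s j (elem_index B i)) \<longlonglongrightarrow>
        complex_of_real (c' i) * t (elem_index C i)"
      by (intro tendsto_mult tendsto_of_real limc i)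
    then show ?thesis
      using True \<open>C \<subseteq> B\<close> i by (auto simp: polar_def)
  next
    case False
    have norm: "cmod (polar I B (s j) (c j) i) = c j i" for j
      using sx[of j] cB[of j] i fin
      by (intro norm_polar) (auto simp: piece_def open_face_def orthant_sphere_def)
    have "c' i = 0" using False i cC by (auto simp: open_face_def supp_def)
    with limc[OF i] have "(\<lambda>j. cmod (polar I B (s j) (c j) i)) \<longlonglongrightarrow> 0"
      by (simp only: norm)
    then have "(\<lambda>j. polar I B (s j) (c j) i) \<longlonglongrightarrow> 0"
      by (rule tendsto_norm_zero_cancel)
    then show ?thesis using False i by (simp add: polar_def)
  qed
  have "limitin (complex_power I) (\<lambda>j. polar I B (s j) (c j)) (polar I C t c') sequentially"
    unfolding limitin_componentwise topspace_powertop
    using comp by (auto simp: polar_def)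
  then show ?thesis
    using limitin_chart_space_iff[of "\<lambda>j. (s j, x j)" "(t, y)" sequentially] sx ty
      piece_subset_pieces[OF B] piece_subset_pieces[OF C]
    by (simp add: ch ch' subset_iff)
qed

end

section \<open>The toral CW complex over the faces\<close>

text \<open>
Dimension, chart and fiber in a toral CW complex are functions of the cell as a set. They are
expressed through the support, which is constant on an open face.
\<close>

definition cell_supp :: "'i set \<Rightarrow> ('i \<Rightarrow> real) set \<Rightarrow> 'i set" where
  "cell_supp I e = (\<Union>c\<in>e. supp I c)"

definition cell_dim :: "'i set \<Rightarrow> ('i \<Rightarrow> real) set \<Rightarrow> nat" where
  "cell_dim I e = card (cell_supp I e) - 1"

definition fiber_dim :: "'i set \<Rightarrow> ('i \<Rightarrow> real) set \<Rightarrow> nat" where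
  "fiber_dim I e = card (cell_supp I e)"

definition cell_chart :: "'i set \<Rightarrow> ('i \<Rightarrow> real) set \<Rightarrow> (nat \<Rightarrow> real) \<Rightarrow> 'i \<Rightarrow> real" where
  "cell_chart I e = face_chart I (cell_supp I e)"

text \<open>
The circle of the smaller face \<open>e'\<close> belonging to a coordinate corresponds to the circle of \<open>e\<close>
belonging to the same coordinate.
\<close>

definition circle_inclusion :: "'i set \<Rightarrow> ('i \<Rightarrow> real) set \<Rightarrow> ('i \<Rightarrow> real) set \<Rightarrow> nat \<Rightarrow> nat" where
  "circle_inclusion I e' e j = elem_index (cell_supp I e) (nth_elem (cell_supp I e') j)"

definition faces :: "'i set \<Rightarrow> 'i set \<Rightarrow> ('i \<Rightarrow> real) set set" where
  "faces I S = open_face I ` {A. A \<subseteq> S \<and> A \<noteq> {}}"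

lemma in_facesE:
  assumes "e \<in> faces I S"
  obtains A where "e = open_face I A" "A \<subseteq> S" "A \<noteq> {}"
  using assms by (auto simp: faces_def)

lemma open_face_nonempty:
  assumes "finite I" "A \<subseteq> I" "A \<noteq> {}"
  shows "open_face I A \<noteq> {}"
proof -
  interpret face I A "card A - 1" using faceI[OF assms] .
  have "(\<lambda>_. 0) \<in> open_ball (card A - 1)" by (simp add: open_ball_eq L2_set_def)
  then show ?thesis using face_chart_open_ball by blast
qed

lemma open_face_subset_closed_face_iff:
  assumes "finite I" "B \<subseteq> I" "B \<noteq> {}"
  shows "open_face I B \<subseteq> closed_face I A \<longleftrightarrow> B \<subseteq> A"
  using open_face_nonempty[OF assms] by (auto simp: open_face_def closed_face_def)

lemma cell_supp_open_face:
  assumes "finite I" "A \<subseteq> I" "A \<noteq> {}"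
  shows "cell_supp I (open_face I A) = A"
  using open_face_nonempty[OF assms] by (auto simp: cell_supp_def open_face_def)

lemma disjoint_open_faces: "A \<noteq> B \<Longrightarrow> open_face I A \<inter> open_face I B = {}"
  by (auto simp: open_face_def)

lemma Union_faces: "\<Union>(faces I S) = closed_face I S"
  by (simp add: faces_def closed_face_eq_Union_open_faces)

lemma finite_faces: "finite S \<Longrightarrow> finite (faces I S)"
  by (simp add: faces_def)

context
  fixes I S :: "'i set"
  assumes fin: "finite I" and SI: "S \<subseteq> I"
begin

abbreviation (input) "face_space \<equiv> subtopology (powertop_real I) (closed_face I S)"
abbreviation (input) "join_space \<equiv> subtopology (complex_power I) (toral_cell I (closed_face I S))"

lemma face_below: "A \<subseteq> S \<Longrightarrow> A \<noteq> {} \<Longrightarrow> face I A (card A - 1)"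
  using fin SI by (intro faceI) auto

lemma cell_invariants:
  assumes "A \<subseteq> S" "A \<noteq> {}"
  shows "cell_supp I (open_face I A) = A" "cell_dim I (open_face I A) = card A - 1"
    "fiber_dim I (open_face I A) = card A" "cell_chart I (open_face I A) = face_chart I A"
  using cell_supp_open_face[of I A] assms fin SI
  by (auto simp: cell_dim_def fiber_dim_def cell_chart_def)

lemma face_mono: "A \<subseteq> S \<Longrightarrow> closed_face I A \<subseteq> closed_face I S"
  by (auto simp: closed_face_def)

lemma closure_of_cell:
  assumes A: "A \<subseteq> S" "A \<noteq> {}"
  shows "face_space closure_of open_face I A = closed_face I A"
proof -
  interpret face I A "card A - 1" using face_below[OF A] .
  have "closed_face I S \<inter> open_face I A = open_face I A"
    using face_mono[OF A(1)] open_face_subset_closed by blast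
  then show ?thesis
    using face_mono[OF A(1)] by (auto simp: closure_of_subtopology closure_of_open_face)
qed

lemma subtopology_closed_cell:
  "A \<subseteq> S \<Longrightarrow> subtopology face_space (closed_face I A) = subtopology (powertop_real I) (closed_face I A)"
  using face_mono by (simp add: subtopology_subtopology Int_absorb1)

lemma topspace_face_space: "topspace face_space = closed_face I S"
  using closed_face_extensional by (simp only: topspace_subtopology topspace_powertop) blast

lemma topspace_join_space: "topspace join_space = toral_cell I (closed_face I S)"
  by (simp only: topspace_subtopology topspace_powertop) (auto simp: toral_cell_def)

lemma card_less_cell_dim:
  assumes "A \<subseteq> S" "B \<subseteq> A" "B \<noteq> {}" "B \<noteq> A"
  shows "card B < card A" "0 < card B"
  using assms SI fin finite_subset[of A I] finite_subset[of B I] psubset_card_mono[of A B]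
  by (auto simp: card_gt_0_iff)

lemma regular_CW_complex_faces:
  "regular_CW_complex face_space (faces I S) (cell_dim I) (cell_chart I)"
  unfolding regular_CW_complex_def
proof (intro conjI ballI)
  show "Hausdorff_space face_space"
    by (simp add: Hausdorff_space_subtopology Hausdorff_powertop)
  show "finite (faces I S)"
    using SI fin finite_subset by (blast intro: finite_faces)
  have "e \<noteq> {}" if "e \<in> faces I S" for e
    using that fin SI open_face_nonempty by (metis in_facesE subset_trans)
  moreover have "disjoint (faces I S)"
    by (auto simp: faces_def disjoint_def open_face_def)
  ultimately show "partition_on (topspace face_space) (faces I S)"
    unfolding partition_on_def topspace_face_space Union_faces by blast
next
  fix e assume "e \<in> faces I S"
  then obtain A where e: "e = open_face I A" and A: "A \<subseteq> S" "A \<noteq> {}" by (rule in_facesE)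
  interpret face I A "card A - 1" using face_below[OF A] .
  show "homeomorphic_map (closed_ball_top (cell_dim I e)) (subtopology face_space (face_space closure_of e)) (cell_chart I e)"
    using homeomorphic_map_face_chart
    by (simp only: e cell_invariants[OF A] closure_of_cell[OF A] subtopology_closed_cell[OF A(1)])
  show "cell_chart I e ` open_ball (cell_dim I e) = e"
    by (simp only: e cell_invariants[OF A] face_chart_open_ball)
  show "cell_chart I e ` (topspace (closed_ball_top (cell_dim I e)) - open_ball (cell_dim I e))
      \<subseteq> \<Union>{e' \<in> faces I S. cell_dim I e' < cell_dim I e}"
  proof (rule image_subsetI, unfold e cell_invariants[OF A])
    fix x assume x: "x \<in> topspace (closed_ball_top (card A - 1)) - open_ball (card A - 1)"
    then have "face_chart I A x \<in> closed_face I A" "face_chart I A x \<notin> open_face I A"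
      using face_chart_in_closed_face face_chart_in_open_face_iff by auto
    then obtain B where B: "B \<subseteq> A" "B \<noteq> {}" "B \<noteq> A" "face_chart I A x \<in> open_face I B"
      unfolding closed_face_eq_Union_open_faces by blast
    have "open_face I B \<in> faces I S" using A B by (auto simp: faces_def)
    moreover have "cell_dim I (open_face I B) < card A - 1"
      using card_less_cell_dim[OF A(1) B(1-3)] cell_invariants(2)[of B] A B by auto
    ultimately show "face_chart I A x \<in> \<Union>{e' \<in> faces I S. cell_dim I e' < card A - 1}"
      using B(4) by blast
  qed
qed

text \<open>
The supports contained in \<open>A\<close> index the pieces, and the dimension \<open>2 * card B - 1\<close> of a toral
cell orders the pieces as the cardinality of the support does.
\<close>

lemma toral_closure_chart_space:
  assumes A: "A \<subseteq> S" "A \<noteq> {}"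
  shows "toral_closure face_space (faces I S) (cell_dim I) (cell_chart I) (fiber_dim I) (circle_inclusion I)
    (open_face I A) (face.chart_space I A (card A - 1))"
proof -
  interpret face I A "card A - 1" using face_below[OF A] .
  let ?e = "open_face I A"
  have F: "{e' \<in> faces I S. e' \<subseteq> face_space closure_of ?e} = open_face I ` {B. B \<subseteq> A \<and> B \<noteq> {}}"
  proof -
    have "{B \<in> {B. B \<subseteq> S \<and> B \<noteq> {}}. open_face I B \<subseteq> closed_face I A} = {B. B \<subseteq> A \<and> B \<noteq> {}}"
    proof (intro Collect_cong)
      fix B
      have "open_face I B \<subseteq> closed_face I A \<longleftrightarrow> B \<subseteq> A" if "B \<subseteq> S" "B \<noteq> {}"
        using that SI by (intro open_face_subset_closed_face_iff fin) auto
      then show "B \<in> {B. B \<subseteq> S \<and> B \<noteq> {}} \<and> open_face I B \<subseteq> closed_face I A \<longleftrightarrow> B \<subseteq> A \<and> B \<noteq> {}"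
        using A(1) by auto
    qed
    moreover have "{e' \<in> open_face I ` T. e' \<subseteq> Z} = open_face I ` {B \<in> T. open_face I B \<subseteq> Z}" for T Z
      by (rule Compr_image_eq)
    ultimately show ?thesis
      unfolding faces_def closure_of_cell[OF A] by (simp only:)
  qed
  have inv: "cell_supp I (open_face I B) = B" "cell_dim I (open_face I B) = card B - 1"
    "fiber_dim I (open_face I B) = card B" "cell_chart I (open_face I B) = face_chart I B"
    "closure_piece (cell_dim I) (cell_chart I) (fiber_dim I) ?e (open_face I B) = piece B"
    "0 < card B"
    if "B \<subseteq> A" "B \<noteq> {}" for B
  proof -
    have BS: "B \<subseteq> S" using that A by blast
    show "cell_supp I (open_face I B) = B" "cell_dim I (open_face I B) = card B - 1"
      "fiber_dim I (open_face I B) = card B" "cell_chart I (open_face I B) = face_chart I B"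
      using cell_invariants[OF BS that(2)] by auto
    show "closure_piece (cell_dim I) (cell_chart I) (fiber_dim I) ?e (open_face I B) = piece B"
      unfolding closure_piece_def piece_def cell_invariants[OF A] cell_invariants[OF BS that(2)] ..
    show "0 < card B"
      using that finite_subset[OF that(1) finite_A] by (simp add: card_gt_0_iff)
  qed
  have TB: "topspace (torus (fiber_dim I ?e)) \<times> open_ball (cell_dim I ?e) = piece A"
    by (simp only: cell_invariants[OF A] piece_top)
  show ?thesis
    unfolding toral_closure_def Let_def F TB
  proof (intro conjI ballI impI allI)
    show "topspace chart_space = (\<Union>e'\<in>open_face I ` {B. B \<subseteq> A \<and> B \<noteq> {}}.
        closure_piece (cell_dim I) (cell_chart I) (fiber_dim I) ?e e')"
      unfolding topspace_chart_space pieces_def image_image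
      by (intro SUP_cong refl inv(5)[symmetric]) auto
    show "metrizable_space chart_space" by (rule metrizable_space_chart_space)
    show "openin chart_space (piece A)" by (rule openin_chart_space_piece_top)
    show "chart_space closure_of piece A = topspace chart_space" by (rule closure_of_piece_top)
    then show "compactin chart_space (chart_space closure_of piece A)" using compactin_chart_space by simp
  next
    fix e' assume "e' \<in> open_face I ` {B. B \<subseteq> A \<and> B \<noteq> {}}"
    then obtain B where "e' = open_face I B" and B: "B \<subseteq> A" "B \<noteq> {}" by blast
    then show "subtopology chart_space (closure_piece (cell_dim I) (cell_chart I) (fiber_dim I) ?e e') =
        prod_topology (torus (fiber_dim I e'))
          (subtopology (closed_ball_top (cell_dim I ?e)) {y. cell_chart I ?e y \<in> e'})"
      by (simp only: inv[OF B] cell_invariants[OF A] subtopology_chart_space_piece[OF B])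
  next
    fix e' e''
    assume "e' \<in> open_face I ` {B. B \<subseteq> A \<and> B \<noteq> {}}" "e'' \<in> open_face I ` {B. B \<subseteq> A \<and> B \<noteq> {}}"
      and le: "e' \<noteq> e'' \<and> fiber_dim I e' + cell_dim I e' \<le> fiber_dim I e'' + cell_dim I e''"
    then obtain B C where "e' = open_face I B" "e'' = open_face I C" and B: "B \<subseteq> A" "B \<noteq> {}"
      and C: "C \<subseteq> A" "C \<noteq> {}" by blast
    from le have "card B + (card B - 1) \<le> card C + (card C - 1)"
      unfolding \<open>e' = _\<close> \<open>e'' = _\<close> inv[OF B] inv[OF C] by (rule conjunct2)
    then have "card B \<le> card C" by linarith
    moreover have "B \<noteq> C" using le \<open>e' = _\<close> \<open>e'' = _\<close> by blast
    ultimately show "\<nexists>f p. range f \<subseteq> closure_piece (cell_dim I) (cell_chart I) (fiber_dim I) ?e e' \<and>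
        p \<in> closure_piece (cell_dim I) (cell_chart I) (fiber_dim I) ?e e'' \<and> limitin chart_space f p sequentially"
      using chart_space_no_limit[OF B C] unfolding \<open>e' = _\<close> \<open>e'' = _\<close> inv[OF B] inv[OF C] by blast
  next
    fix e' e'' s x t y
    assume "e' \<in> open_face I ` {B. B \<subseteq> A \<and> B \<noteq> {}}" "e'' \<in> open_face I ` {B. B \<subseteq> A \<and> B \<noteq> {}}"
    then obtain B C where e: "e' = open_face I B" "e'' = open_face I C" and B: "B \<subseteq> A" "B \<noteq> {}"
      and C: "C \<subseteq> A" "C \<noteq> {}" by blast
    assume "(\<forall>j. (s j, x j) \<in> closure_piece (cell_dim I) (cell_chart I) (fiber_dim I) ?e e') \<and>
      (t, y) \<in> closure_piece (cell_dim I) (cell_chart I) (fiber_dim I) ?e e'' \<and>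
      limitin (closed_ball_top (cell_dim I ?e)) x y sequentially \<and>
      limitin (torus (fiber_dim I e''))
        (\<lambda>j. \<lambda>i\<in>{..<fiber_dim I e''}. s j (circle_inclusion I e'' e' i)) t sequentially"
    then have 1: "\<forall>j. (s j, x j) \<in> closure_piece (cell_dim I) (cell_chart I) (fiber_dim I) ?e e'"
      and 2: "(t, y) \<in> closure_piece (cell_dim I) (cell_chart I) (fiber_dim I) ?e e''"
      and 3: "limitin (closed_ball_top (cell_dim I ?e)) x y sequentially"
      and 4: "limitin (torus (fiber_dim I e''))
        (\<lambda>j. \<lambda>i\<in>{..<fiber_dim I e''}. s j (circle_inclusion I e'' e' i)) t sequentially"
      by auto
    show "limitin chart_space (\<lambda>j. (s j, x j)) (t, y) sequentially"
    proof (rule chart_space_limit[OF B C])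
      show "(s j, x j) \<in> piece B" for j using 1 by (simp only: e inv[OF B])
      show "(t, y) \<in> piece C" using 2 by (simp only: e inv[OF C])
      show "limitin (closed_ball_top (card A - 1)) x y sequentially"
        using 3 by (simp only: cell_invariants[OF A])
      show "limitin (torus (card C))
          (\<lambda>j. \<lambda>i\<in>{..<card C}. s j (elem_index B (nth_elem C i))) t sequentially"
        using 4 by (simp only: e inv[OF C] inv[OF B] circle_inclusion_def)
    qed
  qed
qed

lemma closure_of_toral_cell_in_join_space:
  assumes A: "A \<subseteq> S" "A \<noteq> {}"
  shows "join_space closure_of toral_cell I (open_face I A) = toral_cell I (closed_face I A)"
proof -
  interpret face I A "card A - 1" using face_below[OF A] .
  have "toral_cell I (open_face I A) \<subseteq> toral_cell I (closed_face I S)"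
    "toral_cell I (closed_face I A) \<subseteq> toral_cell I (closed_face I S)"
    using face_mono[OF A(1)] open_face_subset_closed by (auto simp: toral_cell_def)
  then show ?thesis
    by (simp add: closure_of_subtopology Int_absorb1 closure_of_toral_cell)
qed

lemma subtopology_join_space:
  "e \<subseteq> closed_face I S \<Longrightarrow>
    subtopology join_space (toral_cell I e) = subtopology (complex_power I) (toral_cell I e)"
  by (auto simp: subtopology_subtopology toral_cell_def intro!: arg_cong2[where f = subtopology])

lemma toral_cell_nonempty:
  assumes A: "A \<subseteq> S" "A \<noteq> {}"
  shows "toral_cell I (open_face I A) \<noteq> {}"
proof -
  interpret face I A "card A - 1" using face_below[OF A] .
  have "toral_cell I (closed_face I A) \<noteq> {}"
  proof -
    obtain c where "c \<in> open_face I A" using open_face_nonempty[OF fin sub A(2)] by blast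
    moreover have "(\<lambda>j\<in>{..<card A}. 1) \<in> topspace (torus (card A))"
      by (simp add: topspace_torus)
    ultimately show ?thesis
      using polar_image_closed open_face_subset_closed by blast
  qed
  then show ?thesis
    using closure_of_toral_cell by force
qed

lemma toral_homeomorphism:
  assumes A: "A \<subseteq> S" "A \<noteq> {}"
  shows "homeomorphic_map (subtopology join_space (toral_cell I (open_face I A)))
    (prod_topology (torus (card A)) (subtopology face_space (open_face I A)))
    (\<lambda>z. (angles A z, modulus I z))"
proof -
  interpret face I A "card A - 1" using face_below[OF A] .
  have sub': "open_face I A \<subseteq> closed_face I S"
    using face_mono[OF A(1)] open_face_subset_closed by blast
  then have "subtopology face_space (open_face I A) = subtopology (powertop_real I) (open_face I A)"
    by (simp add: subtopology_subtopology Int_absorb1)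
  then show ?thesis
    using homeomorphic_maps_polar[OF finite_A sub]
    unfolding subtopology_join_space[OF sub'] homeomorphic_maps_map by simp
qed

text \<open>
For each cell the witnesses are polar coordinates for \<open>g\<close>, and \<open>toral_chart\<close> with its chart
space for the attaching map. Over the open face \<open>toral_chart\<close> is the inverse of polar coordinates
applied to \<open>face_chart\<close>, which gives the compatibility of \<open>g\<close> with the attaching maps.
\<close>

theorem toral_CW_complex_faces:
  "toral_CW_complex face_space (faces I S) (cell_dim I) (cell_chart I) join_space (toral_cell I) (fiber_dim I)"
  unfolding toral_CW_complex_def
proof (intro conjI ballI exI[of _ "circle_inclusion I"] impI regular_CW_complex_faces)
  show "Hausdorff_space join_space"
    by (simp add: Hausdorff_space_subtopology Hausdorff_powertop)
  show inj: "inj_on (toral_cell I) (faces I S)"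
  proof
    fix e e' assume "e \<in> faces I S" "e' \<in> faces I S" and eq: "toral_cell I e = toral_cell I e'"
    then obtain A B where "e = open_face I A" "A \<subseteq> S" "A \<noteq> {}" "e' = open_face I B"
      by (metis in_facesE)
    with eq toral_cell_nonempty[of A] show "e = e'"
      by (auto simp: toral_cell_def open_face_def)
  qed
  have "disjoint (toral_cell I ` faces I S)"
    by (auto simp: faces_def disjoint_def toral_cell_def open_face_def)
  moreover have "{} \<notin> toral_cell I ` faces I S"
  proof
    assume "{} \<in> toral_cell I ` faces I S"
    then obtain A where "A \<subseteq> S" "A \<noteq> {}" "toral_cell I (open_face I A) = {}"
      by (auto simp: faces_def)
    then show False using toral_cell_nonempty by blast
  qed
  moreover have "\<Union>(toral_cell I ` faces I S) = topspace join_space"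
    using topspace_join_space toral_cell_Union[of I "faces I S"] unfolding Union_faces
    by (rule trans[THEN sym])
  ultimately show "partition_on (topspace join_space) (toral_cell I ` faces I S)"
    unfolding partition_on_def by (intro conjI)
next
  fix e assume "e \<in> faces I S"
  then obtain A where e: "e = open_face I A" and A: "A \<subseteq> S" "A \<noteq> {}" by (rule in_facesE)
  interpret face I A "card A - 1" using face_below[OF A] .
  show "fiber_dim I e = cell_dim I e + 1 \<or> fiber_dim I e = cell_dim I e + 2"
    using card_A by (simp add: e cell_invariants[OF A])
  {
    fix e' assume "e' \<in> faces I S" and "e' \<subseteq> face_space closure_of e"
    then obtain B where e': "e' = open_face I B" and BS: "B \<subseteq> S" "B \<noteq> {}"
      and "open_face I B \<subseteq> closed_face I A"
      unfolding e closure_of_cell[OF A] by (metis in_facesE)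
    then have "B \<subseteq> A"
      using open_face_subset_closed_face_iff[OF fin, of B A] SI by blast
    have fB: "finite B" using \<open>B \<subseteq> A\<close> finite_A finite_subset by blast
    have "circle_inclusion I e' e = elem_index A \<circ> nth_elem B"
      by (simp add: fun_eq_iff circle_inclusion_def e e' cell_invariants[OF A] cell_invariants[OF BS])
    moreover have "inj_on (elem_index A) (nth_elem B ` {..<card B})"
      using bij_betw_nth_elem[OF fB] bij_betw_elem_index[OF finite_A] \<open>B \<subseteq> A\<close>
      by (auto simp: bij_betw_def intro: inj_on_subset)
    ultimately show "inj_on (circle_inclusion I e' e) {..<fiber_dim I e'}"
      using bij_betw_nth_elem[OF fB] by (auto simp: e' cell_invariants[OF BS] bij_betw_def intro: comp_inj_on)
    show "circle_inclusion I e' e ` {..<fiber_dim I e'} \<subseteq> {..<fiber_dim I e}"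
      using elem_index_less[OF finite_A] nth_elem_in[OF fB] \<open>B \<subseteq> A\<close>
      by (auto simp: circle_inclusion_def e e' cell_invariants[OF A] cell_invariants[OF BS])
  }
  have sub_cf: "closed_face I A \<subseteq> closed_face I S" by (rule face_mono[OF A(1)])
  let ?g = "\<lambda>z. (angles A z, modulus I z)"
  show "\<exists>g V \<Phi>. homeomorphic_map (subtopology join_space (toral_cell I e))
        (prod_topology (torus (fiber_dim I e)) (subtopology face_space e)) g \<and>
      toral_closure face_space (faces I S) (cell_dim I) (cell_chart I) (fiber_dim I) (circle_inclusion I) e V \<and>
      homeomorphic_map V (subtopology join_space (join_space closure_of toral_cell I e)) \<Phi> \<and>
      \<Phi> ` (topspace V - topspace (torus (fiber_dim I e)) \<times> open_ball (cell_dim I e))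
        \<subseteq> \<Union>{toral_cell I e' |e'. e' \<in> faces I S \<and>
              fiber_dim I e' + cell_dim I e' < fiber_dim I e + cell_dim I e} \<and>
      (\<forall>s\<in>topspace (torus (fiber_dim I e)). \<forall>y\<in>open_ball (cell_dim I e).
          \<Phi> (s, y) \<in> toral_cell I e \<and> g (\<Phi> (s, y)) = (s, cell_chart I e y))"
  proof (intro exI conjI ballI)
    show "homeomorphic_map (subtopology join_space (toral_cell I e))
        (prod_topology (torus (fiber_dim I e)) (subtopology face_space e)) ?g"
      using toral_homeomorphism[OF A] by (simp only: e cell_invariants[OF A])
    show "toral_closure face_space (faces I S) (cell_dim I) (cell_chart I) (fiber_dim I) (circle_inclusion I) e chart_space"
      using toral_closure_chart_space[OF A] by (simp only: e)
    show "homeomorphic_map chart_space (subtopology join_space (join_space closure_of toral_cell I e)) (toral_chart I A)"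
      using homeomorphic_map_toral_chart
      by (simp only: e closure_of_toral_cell_in_join_space[OF A] subtopology_join_space[OF sub_cf])
    show "toral_chart I A ` (topspace chart_space - topspace (torus (fiber_dim I e)) \<times> open_ball (cell_dim I e))
        \<subseteq> \<Union>{toral_cell I e' |e'. e' \<in> faces I S \<and>
              fiber_dim I e' + cell_dim I e' < fiber_dim I e + cell_dim I e}"
    proof (rule image_subsetI, unfold e cell_invariants[OF A] topspace_chart_space piece_top[symmetric])
      fix p assume "p \<in> pieces - piece A"
      then obtain B where B: "B \<subseteq> A" "B \<noteq> {}" "B \<noteq> A" and p: "p \<in> piece B"
        unfolding pieces_def by blast
      have BS: "B \<subseteq> S" using A B by blast
      have "toral_chart I A p \<in> toral_cell I (open_face I B)"
        using toral_chart_image_piece[OF B(1,2)] p by blast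
      moreover have "open_face I B \<in> faces I S" using BS B by (auto simp: faces_def)
      moreover have "fiber_dim I (open_face I B) + cell_dim I (open_face I B) < card A + (card A - 1)"
        using card_less_cell_dim[OF A(1) B] by (simp add: cell_invariants[OF BS B(2)])
      ultimately show "toral_chart I A p \<in> \<Union>{toral_cell I e' |e'. e' \<in> faces I S \<and>
          fiber_dim I e' + cell_dim I e' < card A + (card A - 1)}"
        by blast
    qed
    fix s y assume s: "s \<in> topspace (torus (fiber_dim I e))" and y: "y \<in> open_ball (cell_dim I e)"
    have s': "s \<in> topspace (torus (card A))" using s by (simp only: e cell_invariants[OF A])
    have c: "face_chart I A y \<in> open_face I A"
      using y face_chart_open_ball by (auto simp: e cell_invariants[OF A])
    then have cc: "face_chart I A y \<in> closed_face I A" using open_face_subset_closed by blast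
    show "toral_chart I A (s, y) \<in> toral_cell I e"
      using c by (simp add: e toral_chart_eq_polar polar_in_toral_cell[OF finite_A s' cc])
    show "?g (toral_chart I A (s, y)) = (s, cell_chart I e y)"
      by (simp add: e cell_invariants[OF A] toral_chart_eq_polar[OF c]
          angles_polar[OF finite_A s' c] modulus_polar[OF finite_A s' cc])
  qed
qed

end

section \<open>Faces indexed by permutations\<close>

lemma permutes_image_complement:
  fixes n l :: nat
  assumes "\<gamma> permutes {1..n}" "l \<le> n"
  shows "\<gamma> ` {l<..n} = {1..n} - \<gamma> ` {1..l}"
proof -
  have "{l<..n} = {1..n} - {1..l}" by auto
  then show ?thesis
    using permutes_inj[OF assms(1)] permutes_image[OF assms(1)]
    by (simp only: image_set_diff)
qed

lemma card_image_perms_inc: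
  assumes "\<gamma> \<in> perms_inc n l"
  shows "card (\<gamma> ` {1..l}) = l"
  using assms card_image[OF inj_on_subset[OF permutes_inj], of \<gamma> "{1..n}" "{1..l}"]
  by (simp add: perms_inc_def)

lemma image_perms_inc_subset:
  assumes "\<gamma> \<in> perms_inc n l" "l \<le> n"
  shows "\<gamma> ` {1..l} \<subseteq> {1..n}"
  using assms permutes_image[of \<gamma> "{1..n}"] image_mono[of "{1..l}" "{1..n}" \<gamma>]
  by (simp add: perms_inc_def)

text \<open>
Complements in \<open>{1..n}\<close> turn the inclusion of the images of the last entries into the reverse
inclusion of the supports.
\<close>

lemma mem_perms_below_iff:
  assumes "\<sigma> \<in> perms_inc n k" "k \<le> n" "l \<le> n"
  shows "\<gamma> \<in> perms_below n k \<sigma> l \<longleftrightarrow> \<gamma> \<in> perms_inc n l \<and> \<gamma> ` {1..l} \<subseteq> \<sigma> ` {1..k}"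
proof -
  have "\<sigma> ` {k<..n} \<subseteq> \<gamma> ` {l<..n} \<longleftrightarrow> \<gamma> ` {1..l} \<subseteq> \<sigma> ` {1..k}" if "\<gamma> \<in> perms_inc n l"
  proof -
    have "\<sigma> permutes {1..n}" "\<gamma> permutes {1..n}"
      using assms(1) that by (simp_all add: perms_inc_def)
    then have c: "\<sigma> ` {k<..n} = {1..n} - \<sigma> ` {1..k}" "\<gamma> ` {l<..n} = {1..n} - \<gamma> ` {1..l}"
      using assms(2,3) by (simp_all only: permutes_image_complement)
    have "U - T \<subseteq> U - V \<longleftrightarrow> V \<subseteq> T" if "V \<subseteq> U" for U V T :: "nat set"
      using that by auto
    then show ?thesis
      unfolding c using image_perms_inc_subset[OF that assms(3)] .
  qed
  then show ?thesis by (auto simp: perms_below_def)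
qed

text \<open>
Both value lists are the increasing enumeration of the same set.
\<close>

lemma strict_mono_on_unique:
  fixes f g :: "nat \<Rightarrow> nat"
  assumes f: "strict_mono_on {a..<b} f" and g: "strict_mono_on {a..<b} g"
    and eq: "f ` {a..<b} = g ` {a..<b}" and "i \<in> {a..<b}"
  shows "f i = g i"
proof -
  have "sorted_wrt (<) (map h [a..<b])" if "strict_mono_on {a..<b} h" for h :: "nat \<Rightarrow> nat"
    using that by (auto simp: sorted_wrt_map strict_mono_on_def intro!: sorted_wrt_mono_rel[OF _ sorted_wrt_upt])
  then have "map f [a..<b] = map g [a..<b]"
    using f g eq strict_sorted_equal[of "map f [a..<b]" "map g [a..<b]"] by simp
  then show ?thesis using \<open>i \<in> {a..<b}\<close> by simp
qed

lemma perms_inc_eqI: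
  assumes "\<gamma> \<in> perms_inc n l" "\<delta> \<in> perms_inc n l" "l \<le> n" and eq: "\<gamma> ` {1..l} = \<delta> ` {1..l}"
  shows "\<gamma> = \<delta>"
proof
  have perm: "\<gamma> permutes {1..n}" "\<delta> permutes {1..n}"
    using assms by (simp_all add: perms_inc_def)
  then have eq': "\<gamma> ` {l<..n} = \<delta> ` {l<..n}"
    using assms(3) eq by (simp only: permutes_image_complement)
  have iv: "{1..l} = {1..<Suc l}" "{l<..n} = {Suc l..<Suc n}" by auto
  fix i
  consider "i \<in> {1..l}" | "i \<in> {l<..n}" | "i \<notin> {1..n}" using assms(3) by force
  then show "\<gamma> i = \<delta> i"
  proof cases
    case 1
    then show ?thesis
      using assms(1,2) eq strict_mono_on_unique[of 1 "Suc l" \<gamma> \<delta> i]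
      unfolding perms_inc_def iv by blast
  next
    case 2
    then show ?thesis
      using assms(1,2) eq' strict_mono_on_unique[of "Suc l" "Suc n" \<gamma> \<delta> i]
      unfolding perms_inc_def iv by blast
  next
    case 3
    then show ?thesis
      using permutes_not_in[OF perm(1)] permutes_not_in[OF perm(2)] by metis
  qed
qed

lemma strict_mono_on_sorted_list_nth:
  assumes "finite A"
  shows "strict_mono_on {a<..a + card A} (\<lambda>i. sorted_list_of_set A ! (i - Suc a))"
proof (rule strict_mono_onI)
  fix r s assume "r \<in> {a<..a + card A}" "s \<in> {a<..a + card A}" "r < s"
  then show "sorted_list_of_set A ! (r - Suc a) < sorted_list_of_set A ! (s - Suc a)"
    using assms strict_sorted_list_of_set[of A]
    by (intro sorted_wrt_nth_less[where P = "(<)"]) auto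
qed

lemma bij_betw_sorted_list_nth:
  assumes "finite A"
  shows "bij_betw (\<lambda>i. sorted_list_of_set A ! (i - Suc a)) {a<..a + card A} A"
proof -
  have "bij_betw (\<lambda>i. i - Suc a) {a<..a + card A} {..<card A}"
    by (rule bij_betwI[of _ _ _ "\<lambda>j. j + Suc a"]) auto
  moreover have "bij_betw ((!) (sorted_list_of_set A)) {..<card A} A"
    using assms by (intro bij_betw_nth) auto
  ultimately show ?thesis
    using bij_betw_trans by (fastforce simp: o_def)
qed

text \<open>
The permutation lists \<open>A\<close> in increasing order, followed by its complement in increasing order.
\<close>

lemma exists_perms_inc:
  assumes A: "A \<subseteq> {1..n}"
  obtains \<gamma> where "\<gamma> \<in> perms_inc n (card A)" "\<gamma> ` {1..card A} = A"
proof -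
  let ?B = "{1..n} - A"
  define l where "l = card A"
  have fin: "finite A" "finite ?B" using A finite_subset by auto
  have ln: "l + card ?B = n"
    using A fin card_mono[OF _ A] by (simp add: card_Diff_subset l_def)
  define f where "f = (\<lambda>i. sorted_list_of_set A ! (i - Suc 0))"
  define g where "g = (\<lambda>i. sorted_list_of_set ?B ! (i - Suc l))"
  define \<gamma> where "\<gamma> i = (if i \<in> {1..l} then f i else if i \<in> {l<..n} then g i else i)" for i
  have iv: "{0<..0 + card A} = {1..l}" "{l<..l + card ?B} = {l<..n}"
    using ln by (auto simp: l_def)
  have f: "bij_betw f {1..l} A" "strict_mono_on {1..l} f"
    using bij_betw_sorted_list_nth[OF fin(1), of 0] strict_mono_on_sorted_list_nth[OF fin(1), of 0]
    unfolding iv f_def by auto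
  have g: "bij_betw g {l<..n} ?B" "strict_mono_on {l<..n} g"
    using bij_betw_sorted_list_nth[OF fin(2), of l] strict_mono_on_sorted_list_nth[OF fin(2), of l]
    unfolding iv g_def by auto
  have "bij_betw \<gamma> {1..l} A"
    using f(1) by (rule bij_betw_cong[THEN iffD1, rotated]) (simp add: \<gamma>_def)
  moreover have "bij_betw \<gamma> {l<..n} ?B"
    using g(1) by (rule bij_betw_cong[THEN iffD1, rotated]) (simp add: \<gamma>_def)
  ultimately have "bij_betw \<gamma> ({1..l} \<union> {l<..n}) (A \<union> ?B)"
    by (rule bij_betw_combine) auto
  moreover have "{1..l} \<union> {l<..n} = {1..n}" "A \<union> ?B = {1..n}"
    using ln A by auto
  ultimately have "\<gamma> permutes {1..n}"
    using ln by (intro bij_imp_permutes) (auto simp: \<gamma>_def)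
  moreover have "strict_mono_on {1..l} \<gamma>" "strict_mono_on {l<..n} \<gamma>"
    using f(2) g(2) by (auto simp: strict_mono_on_def \<gamma>_def)
  ultimately have "\<gamma> \<in> perms_inc n l" by (simp add: perms_inc_def)
  moreover have "\<gamma> ` {1..l} = A"
    using \<open>bij_betw \<gamma> {1..l} A\<close> by (simp add: bij_betw_def)
  ultimately show ?thesis using that by (simp add: l_def)
qed

lemma open_face_alt_def:
  assumes "A \<subseteq> I"
  shows "open_face I A = {c \<in> extensional I. (\<forall>i\<in>I - A. c i = 0) \<and> (\<forall>i\<in>A. 0 < c i) \<and>
    (\<Sum>i\<in>I. (c i)\<^sup>2) = 1}"
proof -
  have "(\<forall>i\<in>I. 0 \<le> c i) \<and> {i \<in> I. c i \<noteq> 0} = A \<longleftrightarrow> (\<forall>i\<in>I - A. c i = 0) \<and> (\<forall>i\<in>A. 0 < c i)"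
    for c :: "'a \<Rightarrow> real"
  proof (intro iffI conjI ballI)
    fix i assume "(\<forall>i\<in>I. 0 \<le> c i) \<and> {i \<in> I. c i \<noteq> 0} = A" "i \<in> A"
    then have "0 \<le> c i" "c i \<noteq> 0" by auto
    then show "0 < c i" by simp
  next
    fix i assume c: "(\<forall>i\<in>I - A. c i = 0) \<and> (\<forall>i\<in>A. 0 < c i)" and "i \<in> I"
    then show "0 \<le> c i" by (cases "i \<in> A") (auto simp: less_imp_le)
  next
    assume c: "(\<forall>i\<in>I - A. c i = 0) \<and> (\<forall>i\<in>A. 0 < c i)"
    have "c i \<noteq> 0 \<longleftrightarrow> i \<in> A" if "i \<in> I" for i
      using c that by (cases "i \<in> A") auto
    then show "{i \<in> I. c i \<noteq> 0} = A" using assms by auto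
  qed auto
  then show ?thesis
    unfolding open_face_def orthant_sphere_def supp_def by blast
qed

lemma pos_sphere_eq_open_face:
  assumes \<gamma>: "\<gamma> \<in> perms_inc n l" and ln: "l \<le> n"
  shows "pos_sphere n l \<gamma> = open_face {1..n} (\<gamma> ` {1..l})"
proof -
  let ?I = "{1..n}" and ?A = "\<gamma> ` {1..l}"
  have perm: "\<gamma> permutes ?I" using \<gamma> by (simp add: perms_inc_def)
  have sub: "?A \<subseteq> ?I" by (rule image_perms_inc_subset[OF \<gamma> ln])
  have inj: "inj_on \<gamma> {1..l}"
    using permutes_inj[OF perm] by (rule inj_on_subset) simp
  have zero: "(\<forall>i\<in>{l<..n}. c (\<gamma> i) = 0) \<longleftrightarrow> (\<forall>i\<in>?I - ?A. c i = 0)" for c :: "nat \<Rightarrow> real"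
    unfolding permutes_image_complement[OF perm ln, symmetric] by simp
  have pos: "(\<forall>i\<in>{1..l}. 0 < c (\<gamma> i)) \<longleftrightarrow> (\<forall>i\<in>?A. 0 < c i)" for c :: "nat \<Rightarrow> real"
    by simp
  have sum: "(\<Sum>i\<in>{1..l}. (c (\<gamma> i))\<^sup>2) = (\<Sum>i\<in>?I. (c i)\<^sup>2)"
    if "\<forall>i\<in>?I - ?A. c i = 0" for c :: "nat \<Rightarrow> real"
  proof -
    have "(\<Sum>i\<in>{1..l}. (c (\<gamma> i))\<^sup>2) = (\<Sum>i\<in>?A. (c i)\<^sup>2)"
      using inj by (simp add: sum.reindex)
    also have "\<dots> = (\<Sum>i\<in>?I. (c i)\<^sup>2)"
      using sub that by (intro sum.mono_neutral_left) auto
    finally show ?thesis .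
  qed
  have "c \<in> pos_sphere n l \<gamma> \<longleftrightarrow> c \<in> extensional ?I \<and> (\<forall>i\<in>?I - ?A. c i = 0) \<and>
      (\<forall>i\<in>?A. 0 < c i) \<and> (\<Sum>i\<in>?I. (c i)\<^sup>2) = 1" for c
    unfolding pos_sphere_def topspace_powertop mem_Collect_eq zero pos using sum[of c] by argo
  then show ?thesis
    unfolding open_face_alt_def[OF sub] by blast
qed

lemma pos_sphere_below:
  assumes \<sigma>: "\<sigma> \<in> perms_inc n k" "k \<le> n" and l: "l \<in> {1..k}" and below: "\<gamma> \<in> perms_below n k \<sigma> l"
  shows "\<gamma> \<in> perms_inc n l" "\<gamma> ` {1..l} \<subseteq> \<sigma> ` {1..k}" "\<gamma> ` {1..l} \<noteq> {}"
    "card (\<gamma> ` {1..l}) = l" "pos_sphere n l \<gamma> = open_face {1..n} (\<gamma> ` {1..l})"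
proof -
  have ln: "l \<le> n" using l \<sigma>(2) by simp
  show \<gamma>: "\<gamma> \<in> perms_inc n l" and "\<gamma> ` {1..l} \<subseteq> \<sigma> ` {1..k}"
    using below mem_perms_below_iff[OF \<sigma> ln] by simp_all
  show "\<gamma> ` {1..l} \<noteq> {}" using l by simp
  show "card (\<gamma> ` {1..l}) = l" by (rule card_image_perms_inc[OF \<gamma>])
  show "pos_sphere n l \<gamma> = open_face {1..n} (\<gamma> ` {1..l})" by (rule pos_sphere_eq_open_face[OF \<gamma> ln])
qed

text \<open>
The number \<open>l\<close> is the cardinality of the support, and \<open>\<gamma>\<close> lists the support first.
\<close>

lemma open_face_is_pos_sphere:
  assumes \<sigma>: "\<sigma> \<in> perms_inc n k" "k \<le> n" and A: "A \<subseteq> \<sigma> ` {1..k}" "A \<noteq> {}"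
  obtains l \<gamma> where "l \<in> {1..k}" "\<gamma> \<in> perms_below n k \<sigma> l" "open_face {1..n} A = pos_sphere n l \<gamma>"
proof -
  have "finite A" using A(1) by (rule finite_subset) simp
  moreover have "card A \<le> k"
    using card_mono[OF _ A(1)] card_image_perms_inc[OF \<sigma>(1)] by simp
  ultimately have lk: "card A \<in> {1..k}"
    using A(2) by (simp add: Suc_le_eq card_gt_0_iff)
  then have ln: "card A \<le> n" using \<sigma>(2) by simp
  have "A \<subseteq> {1..n}" using A(1) image_perms_inc_subset[OF \<sigma>] by blast
  then obtain \<gamma> where \<gamma>: "\<gamma> \<in> perms_inc n (card A)" "\<gamma> ` {1..card A} = A"
    by (rule exists_perms_inc)
  show ?thesis
  proof (rule that[OF lk])
    show "\<gamma> \<in> perms_below n k \<sigma> (card A)"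
      unfolding mem_perms_below_iff[OF \<sigma> ln] \<gamma>(2) using \<gamma>(1) A(1) by (rule conjI)
    show "open_face {1..n} A = pos_sphere n (card A) \<gamma>"
      unfolding pos_sphere_eq_open_face[OF \<gamma>(1) ln] \<gamma>(2) ..
  qed
qed

lemma pos_sphere_cells_eq_faces:
  assumes "\<sigma> \<in> perms_inc n k" "k \<le> n"
  shows "pos_sphere_cells n k \<sigma> = faces {1..n} (\<sigma> ` {1..k})"
proof
  show "pos_sphere_cells n k \<sigma> \<subseteq> faces {1..n} (\<sigma> ` {1..k})"
  proof
    fix e assume "e \<in> pos_sphere_cells n k \<sigma>"
    then obtain l \<gamma> where "e = pos_sphere n l \<gamma>" and l: "l \<in> {1..k}" "\<gamma> \<in> perms_below n k \<sigma> l"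
      unfolding pos_sphere_cells_def by blast
    then show "e \<in> faces {1..n} (\<sigma> ` {1..k})"
      using pos_sphere_below(2,3,5)[OF assms l] unfolding faces_def by blast
  qed
  show "faces {1..n} (\<sigma> ` {1..k}) \<subseteq> pos_sphere_cells n k \<sigma>"
  proof
    fix e assume "e \<in> faces {1..n} (\<sigma> ` {1..k})"
    then obtain A where e: "e = open_face {1..n} A" and A: "A \<subseteq> \<sigma> ` {1..k}" "A \<noteq> {}"
      by (rule in_facesE)
    obtain l \<gamma> where "l \<in> {1..k}" "\<gamma> \<in> perms_below n k \<sigma> l" "open_face {1..n} A = pos_sphere n l \<gamma>"
      using open_face_is_pos_sphere[OF assms A] .
    then show "e \<in> pos_sphere_cells n k \<sigma>"
      unfolding pos_sphere_cells_def e by blast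
  qed
qed

lemma closed_pos_sphere_eq_closed_face:
  assumes "\<sigma> \<in> perms_inc n k" "1 \<le> k" "k \<le> n"
  shows "closed_pos_sphere n k \<sigma> = closed_face {1..n} (\<sigma> ` {1..k})"
proof -
  have "\<sigma> ` {1..k} \<noteq> {}" using assms(2) by simp
  from face.closure_of_open_face[OF faceI[OF _ image_perms_inc_subset[OF assms(1,3)] this]]
  show ?thesis
    by (simp only: closed_pos_sphere_def pos_sphere_eq_open_face[OF assms(1,3)] finite_atLeastAtMost)
qed

text \<open>
The support of a cell determines \<open>l\<close> as its cardinality, and then \<open>\<gamma>\<close> by monotonicity; cells with
different supports are disjoint.
\<close>

lemma disjoint_pos_spheres:
  assumes \<sigma>: "\<sigma> \<in> perms_inc n k" "k \<le> n"
  shows "disjoint_family_on (\<lambda>(l, \<gamma>). pos_sphere n l \<gamma>) (SIGMA l:{1..k}. perms_below n k \<sigma> l)"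
  unfolding disjoint_family_on_def
proof (intro ballI impI)
  fix p q assume p: "p \<in> (SIGMA l:{1..k}. perms_below n k \<sigma> l)"
    and q: "q \<in> (SIGMA l:{1..k}. perms_below n k \<sigma> l)" and "p \<noteq> q"
  obtain l \<gamma> l' \<gamma>' where pq: "p = (l, \<gamma>)" "q = (l', \<gamma>')" by fastforce
  then have cp: "l \<in> {1..k}" "\<gamma> \<in> perms_below n k \<sigma> l" and cq: "l' \<in> {1..k}" "\<gamma>' \<in> perms_below n k \<sigma> l'"
    using p q by auto
  note \<gamma> = pos_sphere_below[OF \<sigma> cp] and \<gamma>' = pos_sphere_below[OF \<sigma> cq]
  have "\<gamma> ` {1..l} \<noteq> \<gamma>' ` {1..l'}"
  proof
    assume eq: "\<gamma> ` {1..l} = \<gamma>' ` {1..l'}"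
    then have l: "l' = l" using \<gamma>(4) \<gamma>'(4) by metis
    have "\<gamma> = \<gamma>'"
    proof (rule perms_inc_eqI[OF \<gamma>(1)])
      show "\<gamma>' \<in> perms_inc n l" using \<gamma>'(1) unfolding l .
      show "l \<le> n" using cp(1) \<sigma>(2) by simp
      show "\<gamma> ` {1..l} = \<gamma>' ` {1..l}" using eq unfolding l .
    qed
    with l show False using \<open>p \<noteq> q\<close> pq by simp
  qed
  then show "(case p of (l, \<gamma>) \<Rightarrow> pos_sphere n l \<gamma>) \<inter> (case q of (l, \<gamma>) \<Rightarrow> pos_sphere n l \<gamma>) = {}"
    unfolding pq prod.case \<gamma>(5) \<gamma>'(5) by (rule disjoint_open_faces)
qed

lemma toral_cell_homeomorphic_product:
  assumes "finite I" "S \<subseteq> I" "A \<subseteq> S" "A \<noteq> {}"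
  shows "subtopology (subtopology (complex_power I) (toral_cell I (closed_face I S)))
      (toral_cell I (open_face I A)) homeomorphic_space
    prod_topology (torus (card A)) (subtopology (powertop_real I) (open_face I A))"
proof -
  have "open_face I A \<subseteq> closed_face I S"
    using assms(3) by (auto simp: open_face_def closed_face_def)
  then have "subtopology (subtopology (powertop_real I) (closed_face I S)) (open_face I A) =
      subtopology (powertop_real I) (open_face I A)"
    by (simp add: subtopology_subtopology Int_absorb1)
  then show ?thesis
    using homeomorphic_map_imp_homeomorphic_space[OF toral_homeomorphism[OF assms]] by (simp only:)
qed

lemma odd_toral_cell_dim:
  assumes "finite I" "S \<subseteq> I" "e \<in> faces I S"
  shows "odd (fiber_dim I e + cell_dim I e)"
proof -
  obtain A where A: "e = open_face I A" "A \<subseteq> S" "A \<noteq> {}"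
    using assms(3) by (rule in_facesE)
  have "finite A" by (rule finite_subset[OF subset_trans[OF A(2) assms(2)] assms(1)])
  then have "card A > 0" using A(3) by (simp add: card_gt_0_iff)
  then have "card A + (card A - 1) = 2 * (card A - 1) + 1" by simp
  then show ?thesis
    unfolding A(1) cell_invariants[OF assms(1,2) A(2,3)] by simp
qed

lemma closed_pos_sphere_eq_Union:
  assumes "\<sigma> \<in> perms_inc n k" "1 \<le> k" "k \<le> n"
  shows "closed_pos_sphere n k \<sigma> = (\<Union>l\<in>{1..k}. \<Union>\<gamma>\<in>perms_below n k \<sigma> l. pos_sphere n l \<gamma>)"
proof -
  have "(\<Union>l\<in>{1..k}. \<Union>\<gamma>\<in>perms_below n k \<sigma> l. pos_sphere n l \<gamma>) = \<Union>(pos_sphere_cells n k \<sigma>)"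
    unfolding pos_sphere_cells_def by blast
  then show ?thesis
    unfolding closed_pos_sphere_eq_closed_face[OF assms] pos_sphere_cells_eq_faces[OF assms(1,3)]
      Union_faces by (rule sym)
qed

lemma toral_CW_complex_pos_spheres:
  assumes "\<sigma> \<in> perms_inc n k" "1 \<le> k" "k \<le> n"
  shows "toral_CW_complex (subtopology (powertop_real {1..n}) (closed_pos_sphere n k \<sigma>))
    (pos_sphere_cells n k \<sigma>) (cell_dim {1..n}) (cell_chart {1..n})
    (subtopology (complex_power {1..n}) (toral_cell {1..n} (closed_pos_sphere n k \<sigma>)))
    (toral_cell {1..n}) (fiber_dim {1..n})"
  unfolding closed_pos_sphere_eq_closed_face[OF assms] pos_sphere_cells_eq_faces[OF assms(1,3)]
  by (rule toral_CW_complex_faces[OF finite_atLeastAtMost image_perms_inc_subset[OF assms(1,3)]])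

lemma cell_dim_pos_sphere:
  assumes "\<sigma> \<in> perms_inc n k" "k \<le> n" and l: "l \<in> {1..k}" "\<gamma> \<in> perms_below n k \<sigma> l"
  shows "cell_dim {1..n} (pos_sphere n l \<gamma>) = l - 1"
proof -
  note cell = pos_sphere_below[OF assms]
  note dim = cell_invariants(2)[OF finite_atLeastAtMost image_perms_inc_subset[OF assms(1,2)] cell(2,3)]
  show ?thesis unfolding cell(5) dim cell(4) ..
qed

lemma toral_cell_pos_sphere_homeomorphic:
  assumes \<sigma>: "\<sigma> \<in> perms_inc n k" "1 \<le> k" "k \<le> n"
    and l: "l \<in> {0..k-1}" and \<gamma>: "\<gamma> \<in> perms_below n k \<sigma> (l+1)"
  shows "subtopology (subtopology (complex_power {1..n}) (toral_cell {1..n} (closed_pos_sphere n k \<sigma>)))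
      (toral_cell {1..n} (pos_sphere n (l+1) \<gamma>)) homeomorphic_space
    prod_topology (torus (l+1)) (subtopology (powertop_real {1..n}) (pos_sphere n (l+1) \<gamma>))"
proof -
  have "l + 1 \<in> {1..k}" using l \<sigma>(2) by auto
  note cell = pos_sphere_below[OF \<sigma>(1,3) this \<gamma>]
  show ?thesis
    using toral_cell_homeomorphic_product[OF finite_atLeastAtMost image_perms_inc_subset[OF \<sigma>(1,3)] cell(2,3)]
    unfolding cell(4,5) closed_pos_sphere_eq_closed_face[OF \<sigma>] .
qed

lemma no_even_toral_cell:
  assumes "\<sigma> \<in> perms_inc n k" "k \<le> n"
  shows "\<not> (\<exists>e\<in>pos_sphere_cells n k \<sigma>. even (fiber_dim {1..n} e + cell_dim {1..n} e))"
  unfolding pos_sphere_cells_eq_faces[OF assms]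
  using odd_toral_cell_dim[OF finite_atLeastAtMost image_perms_inc_subset[OF assms]] by blast

text \<open>
The witnesses are explicit: \<open>X\<close> is the part of the unit sphere of $\mathbb{C}^n$ whose moduli form a
point of the closed cell, which is the unit sphere of $\mathbb{C}^S$.
\<close>

lemma pos_spheres_toral_complex:
  assumes "\<sigma> \<in> perms_inc n k" "1 \<le> k" "k \<le> n"
  defines "X \<equiv> subtopology (complex_power {1..n}) (toral_cell {1..n} (closed_pos_sphere n k \<sigma>))"
  shows "closed_pos_sphere n k \<sigma> = (\<Union>l\<in>{1..k}. \<Union>\<gamma>\<in>perms_below n k \<sigma> l. pos_sphere n l \<gamma>) \<and>
    disjoint_family_on (\<lambda>(l, \<gamma>). pos_sphere n l \<gamma>) (SIGMA l:{1..k}. perms_below n k \<sigma> l) \<and>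
    toral_CW_complex (subtopology (powertop_real {1..n}) (closed_pos_sphere n k \<sigma>))
      (pos_sphere_cells n k \<sigma>) (cell_dim {1..n}) (cell_chart {1..n}) X (toral_cell {1..n})
      (fiber_dim {1..n}) \<and>
    (\<forall>l\<in>{1..k}. \<forall>\<gamma>\<in>perms_below n k \<sigma> l. cell_dim {1..n} (pos_sphere n l \<gamma>) = l - 1) \<and>
    (\<forall>l\<in>{0..k-1}. \<forall>\<gamma>\<in>perms_below n k \<sigma> (l+1).
      subtopology X (toral_cell {1..n} (pos_sphere n (l+1) \<gamma>)) homeomorphic_space
      prod_topology (torus (l+1)) (subtopology (powertop_real {1..n}) (pos_sphere n (l+1) \<gamma>))) \<and>
    \<not> (\<exists>e\<in>pos_sphere_cells n k \<sigma>. even (fiber_dim {1..n} e + cell_dim {1..n} e))"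
  unfolding X_def
  using closed_pos_sphere_eq_Union[OF assms(1-3)] disjoint_pos_spheres[OF assms(1,3)]
    toral_CW_complex_pos_spheres[OF assms(1-3)] cell_dim_pos_sphere[OF assms(1,3)]
    toral_cell_pos_sphere_homeomorphic[OF assms(1-3)] no_even_toral_cell[OF assms(1,3)]
  by (intro conjI ballI)

theorem lemma6p7:
  fixes n k :: nat and \<sigma> :: "nat \<Rightarrow> nat"
  assumes "1 \<le> k" and "k \<le> n" and "\<sigma> \<in> perms_inc n k"
  shows "closed_pos_sphere n k \<sigma> = (\<Union>l\<in>{1..k}. \<Union>\<gamma>\<in>perms_below n k \<sigma> l. pos_sphere n l \<gamma>) \<and>
    disjoint_family_on (\<lambda>(l, \<gamma>). pos_sphere n l \<gamma>) (SIGMA l:{1..k}. perms_below n k \<sigma> l) \<and>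
    (\<exists>(d :: (nat \<Rightarrow> real) set \<Rightarrow> nat) \<phi> (X :: (nat \<Rightarrow> complex) topology) C m.
       toral_CW_complex (subtopology (powertop_real {1..n}) (closed_pos_sphere n k \<sigma>))
         (pos_sphere_cells n k \<sigma>) d \<phi> X C m \<and>
       (\<forall>l\<in>{1..k}. \<forall>\<gamma>\<in>perms_below n k \<sigma> l. d (pos_sphere n l \<gamma>) = l - 1) \<and>
       (\<forall>l\<in>{0..k-1}. \<forall>\<gamma>\<in>perms_below n k \<sigma> (l+1).
          subtopology X (C (pos_sphere n (l+1) \<gamma>)) homeomorphic_space
          prod_topology (torus (l+1))
            (subtopology (powertop_real {1..n}) (pos_sphere n (l+1) \<gamma>))) \<and>
       \<not> (\<exists>e\<in>pos_sphere_cells n k \<sigma>. even (m e + d e)))"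
  using pos_spheres_toral_complex[OF assms(3,1,2)] by blast

end
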